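(* Let $p\geq 2$ and $\bar\eta\geq 1$ be integers and let $D\subset\mathbb{R}^2$ be a finite digit set such that $\mathcal{Z}(m_D)\subset\mathring{E}_{p^{\bar\eta}}^2+\mathbb{Z}^2$. Then for every expanding matrix $M\in M_2(\mathbb{Z})$ with $\gcd(\det(M),p)=1$ there exist at most $p^{2\bar\eta}$ mutually orthogonal exponential functions in $L^2(\mu_{M,D})$. Moreover, if $p\geq 3$ is a prime and there exists $\mathcal{N}\in\mathbb{Z}\setminus p\mathbb{Z}$ such that $\mathcal{N}(\mathcal{A}_p(\bar\eta)+\mathbb{Z}^2)\subset\mathcal{Z}(m_D)$, then the number $p^{2\bar\eta}$ is the best: there exists an expanding matrix $M\in M_2(\mathbb{Z})$ with $\gcd(\det(M),p)=1$ for which $L^2(\mu_{M,D})$ contains $p^{2\bar\eta}$ mutually orthogonal exponential functions.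
   Context: A square real matrix $M$ is expanding if all its eigenvalues have modulus $>1$. For an expanding matrix $M\in M_n(\mathbb{R})$ and a finite digit set $D\subset\mathbb{R}^n$ put $\phi_d(x)=M^{-1}(x+d)$; the self-affine measure $\mu_{M,D}$ is the unique Borel probability measure $\mu$ on $\mathbb{R}^n$ with $\mu=\frac{1}{|D|}\sum_{d\in D}\mu\circ\phi_d^{-1}$. The mask polynomial of $D$ is $m_D(x)=\frac{1}{|D|}\sum_{d\in D}e^{2\pi i\langle d,x\rangle}$, $x\in\mathbb{R}^n$, and $\mathcal{Z}(m_D)=\{x\in\mathbb{R}^n: m_D(x)=0\}$. For an integer $q\ge2$, $E_q^2=\frac1q\{(l_1,l_2)^t: 0\le l_1,l_2\le q-1,\ l_i\in\mathbb{Z}\}$ and $\mathring{E}_q^2=E_q^2\setminus\{0\}$. For integers $p\ge 2$, $s\ge1$, $\mathcal{A}_p(s)=\frac{1}{p^s}\{(p^{s-1},l)^t: 0\le l\le p^s-1,\ l\in\mathbb{Z}\}$. Exponential functions are the functions $x\mapsto e^{2\pi i\langle\lambda,x\rangle}$, $\lambda\in\mathbb{R}^n$. "There exist at most $k$ mutually orthogonal exponential functions in $L^2(\mu)$" means: if $\Lambda\subset\mathbb{R}^n$ is such that $e^{2\pi i\langle\lambda,x\rangle}$ and $e^{2\pi i\langle\lambda',x\rangle}$ are orthogonal in $L^2(\mu)$ for all distinct $\lambda,\lambda'\in\Lambda$, then $|\Lambda|\le k$. "$L^2(\mu)$ contains $k$ mutually orthogonal exponential functions" means that such a $\Lambda$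 with $|\Lambda|=k$ exists. *)

theory Defs
  imports "HOL-Analysis.Analysis"
begin

definition eigenvalue_of :: "real^'n^'n \<Rightarrow> complex \<Rightarrow> bool" where
  "eigenvalue_of M c \<longleftrightarrow>
     (\<exists>v::complex^'n. v \<noteq> 0 \<and> map_matrix complex_of_real M *v v = c *s v)"

definition expanding :: "real^'n^'n \<Rightarrow> bool" where
  "expanding M \<longleftrightarrow> (\<forall>c. eigenvalue_of M c \<longrightarrow> norm c > 1)"

(* An expanding matrix has no eigenvalue 0, so matrix_inv is then a genuine inverse. *)
definition ifs_map :: "real^'n^'n \<Rightarrow> real^'n \<Rightarrow> real^'n \<Rightarrow> real^'n" where
  "ifs_map M d x = matrix_inv M *v (x + d)"

definition is_self_affine_measure ::
  "real^'n^'n \<Rightarrow> (real^'n) set \<Rightarrow> (real^'n) measure \<Rightarrow> bool" where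
  "is_self_affine_measure M D \<mu> \<longleftrightarrow>
     sets \<mu> = sets borel \<and> emeasure \<mu> UNIV = 1 \<and>
     (\<forall>A\<in>sets borel.
        measure \<mu> A = 1 / real (card D) * (\<Sum>d\<in>D. measure (distr \<mu> borel (ifs_map M d)) A))"

(* For expanding M and finite nonempty D there is exactly one such measure (Hutchinson);
   otherwise the value may be unspecified. *)
definition self_affine_measure :: "real^'n^'n \<Rightarrow> (real^'n) set \<Rightarrow> (real^'n) measure" where
  "self_affine_measure M D = (THE \<mu>. is_self_affine_measure M D \<mu>)"

definition expo :: "real^'n \<Rightarrow> real^'n \<Rightarrow> complex" where
  "expo l x = exp (2 * of_real pi * \<i> * of_real (l \<bullet> x))"

definition mask_poly :: "(real^'n) set \<Rightarrow> real^'n \<Rightarrow> complex" where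
  "mask_poly D x = 1 / of_nat (card D) * (\<Sum>d\<in>D. expo d x)"

definition zero_set :: "(real^'n \<Rightarrow> complex) \<Rightarrow> (real^'n) set" where
  "zero_set f = {x. f x = 0}"

definition int_lattice :: "(real^'n) set" where
  "int_lattice = {x. \<forall>i. x $ i \<in> \<int>}"

definition E2 :: "nat \<Rightarrow> (real^2) set" where
  "E2 q = {(1 / real q) *\<^sub>R vector [of_int l1, of_int l2] | l1 l2 :: int.
             0 \<le> l1 \<and> l1 \<le> int q - 1 \<and> 0 \<le> l2 \<and> l2 \<le> int q - 1}"

definition E2_ring :: "nat \<Rightarrow> (real^2) set" where
  "E2_ring q = E2 q - {0}"

(* Intended for s >= 1 only, where the natural-number subtraction s - 1 is not truncated. *)
definition A_set :: "nat \<Rightarrow> nat \<Rightarrow> (real^2) set" where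
  "A_set p s = {(1 / real (p ^ s)) *\<^sub>R vector [real (p ^ (s - 1)), of_int l] | l :: int.
                  0 \<le> l \<and> l \<le> int (p ^ s) - 1}"

definition L2_inner :: "'a measure \<Rightarrow> ('a \<Rightarrow> complex) \<Rightarrow> ('a \<Rightarrow> complex) \<Rightarrow> complex" where
  "L2_inner \<mu> f g = (LINT x|\<mu>. f x * cnj (g x))"

(* For a finite Borel measure the exponentials are bounded and measurable, hence lie in L^2 and
   the Bochner integral in L2_inner is a genuine one (not the default value 0). *)
definition orthogonal_exponentials :: "(real^'n) measure \<Rightarrow> (real^'n) set \<Rightarrow> bool" where
  "orthogonal_exponentials \<mu> \<Lambda> \<longleftrightarrow>
     (\<forall>l\<in>\<Lambda>. \<forall>l'\<in>\<Lambda>. l \<noteq> l' \<longrightarrow> L2_inner \<mu> (expo l) (expo l') = 0)"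

definition at_most_orthogonal_exponentials :: "(real^'n) measure \<Rightarrow> nat \<Rightarrow> bool" where
  "at_most_orthogonal_exponentials \<mu> k \<longleftrightarrow>
     (\<forall>\<Lambda>. orthogonal_exponentials \<mu> \<Lambda> \<longrightarrow> finite \<Lambda> \<and> card \<Lambda> \<le> k)"

definition contains_orthogonal_exponentials :: "(real^'n) measure \<Rightarrow> nat \<Rightarrow> bool" where
  "contains_orthogonal_exponentials \<mu> k \<longleftrightarrow>
     (\<exists>\<Lambda>. orthogonal_exponentials \<mu> \<Lambda> \<and> finite \<Lambda> \<and> card \<Lambda> = k)"

end

theory Submission
  imports Defs "HOL-Probability.Probability" "HOL-Algebra.Multiplicative_Group"
begin

text \<open>
  Write $\mu$ for the self-affine measure. Iterating the self-similarity shows that $\hat\mu$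
  vanishes exactly on the union of the sets $(M^T)^k Z(m_D)$ with $k \geq 1$, so frequencies are
  orthogonal iff their differences lie in this union. Put $q = p^\eta$.

  Upper bound: the set of points of $\frac1q Z^2$ outside $Z^2$ is invariant under $M^T$ since
  $\det M$ is prime to $p$. Hence frequencies are pairwise distinct modulo $Z^2$ inside one coset
  of $\frac1q Z^2$, which leaves room for $q^2$ of them.

  Sharpness: it suffices that the orbit under $M^T$ of every integer vector that is nonzero modulo
  $q$ contains a vector with first coordinate $p^{\eta-1}$ modulo $q$; then
  $\frac Nq (M^T)^K \{0,\dots,q-1\}^2$ works for large $K$. Choose $m \geq 2$ such that $-m$ is not a
  square modulo $p$, and let $M^T$ be multiplication by $\alpha$ on $Z[\sqrt{-m}]$, where $\alpha$
  generates the multiplicative group of the field with $p^2$ elements and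
  $\alpha^{p^2-1} = 1 + p\beta$ with the coefficient of $\sqrt{-m}$ in $\beta$ prime to $p$. Powers of
  $\alpha$ act transitively modulo $p$, and from a vector congruent to $\sqrt{-m}$ the powers of
  $1 + p\beta$ reach every first coordinate divisible by $p$, modulo any power of $p$.
\<close>

section \<open>Self-affine measures and their Fourier transforms\<close>

lemma measurable_ifs_map [measurable]:
  "ifs_map M d \<in> borel_measurable borel"
proof -
  have "continuous_on UNIV (ifs_map M d)"
    unfolding ifs_map_def
    by (intro continuous_intros continuous_on_compose2[OF matrix_vector_mult_linear_continuous_on]) auto
  then show ?thesis by (rule borel_measurable_continuous_onI)
qed

lemma measurable_matrix_vector_mult [measurable]:
  fixes A :: "real^'n^'m"
  shows "(\<lambda>x. A *v x) \<in> borel_measurable borel"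
  by (intro borel_measurable_continuous_onI matrix_vector_mult_linear_continuous_on)

lemma self_affine_prob_space:
  assumes "is_self_affine_measure M D \<mu>"
  shows "prob_space \<mu>"
proof
  have "sets \<mu> = sets borel" using assms by (simp add: is_self_affine_measure_def)
  then have "space \<mu> = UNIV" by (metis sets_eq_imp_space_eq space_borel)
  then show "emeasure \<mu> (space \<mu>) = 1" using assms by (simp add: is_self_affine_measure_def)
qed

text \<open>A random digit and an independent point of law \<mu> are fed into the map. In this form
  self-affinity is a single pushforward, to which \<open>integral_distr\<close> and Fubini
  apply.\<close>

lemma self_affine_eq_distr:
  fixes M :: "real^'n^'n"
  assumes \<mu>: "is_self_affine_measure M D \<mu>" and D: "finite D" "D \<noteq> {}"
  shows "\<mu> = distr (measure_pmf (pmf_of_set D) \<Otimes>\<^sub>M \<mu>) borel (\<lambda>(d, x). ifs_map M d x)"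
proof -
  interpret prob_space \<mu> using \<mu> by (rule self_affine_prob_space)
  have [measurable_cong]: "sets \<mu> = sets borel"
    using \<mu> by (simp add: is_self_affine_measure_def)
  have sp: "space \<mu> = UNIV"
    by (metis \<open>sets \<mu> = sets borel\<close> sets_eq_imp_space_eq space_borel)
  let ?P = "measure_pmf (pmf_of_set D) \<Otimes>\<^sub>M \<mu>"
  \<comment> \<open>The law of the digit carries the discrete sigma-algebra; composing with the
    identity into \<open>borel\<close> turns the digit into a Borel variable.\<close>
  have id: "(\<lambda>d. d) \<in> measure_pmf (pmf_of_set D) \<rightarrow>\<^sub>M (borel :: (real^'n) measure)"
    by simp
  have [measurable]: "fst \<in> borel_measurable ?P"
    by (rule measurable_compose[OF measurable_fst id])
  have m: "(\<lambda>(d, x). ifs_map M d x) \<in> borel_measurable ?P"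
    unfolding ifs_map_def case_prod_beta by measurable
  show ?thesis
  proof (rule measure_eqI)
    show "sets \<mu> = sets (distr ?P borel (\<lambda>(d, x). ifs_map M d x))" by (simp add: \<open>sets \<mu> = sets borel\<close>)
    fix A assume "A \<in> sets \<mu>"
    then have A [measurable]: "A \<in> sets borel" using \<open>sets \<mu> = sets borel\<close> by simp
    have "emeasure (distr ?P borel (\<lambda>(d, x). ifs_map M d x)) A
        = emeasure ?P ((\<lambda>(d, x). ifs_map M d x) -` A \<inter> space ?P)"
      by (rule emeasure_distr[OF m A])
    also have "\<dots> = (\<integral>\<^sup>+d. emeasure \<mu> (ifs_map M d -` A) \<partial>measure_pmf (pmf_of_set D))"
      using measurable_sets[OF m A]
      by (subst emeasure_pair_measure_alt) (auto simp: space_pair_measure sp vimage_def)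
    also have "\<dots> = (\<Sum>d\<in>D. emeasure \<mu> (ifs_map M d -` A)) / card D"
      by (subst nn_integral_pmf_of_set) (use D in auto)
    also have "\<dots> = (\<Sum>d\<in>D. ennreal (measure (distr \<mu> borel (ifs_map M d)) A)) / card D"
    proof -
      have "emeasure \<mu> (ifs_map M d -` A) = ennreal (measure (distr \<mu> borel (ifs_map M d)) A)" for d
        by (subst measure_distr) (auto simp: sp emeasure_eq_measure)
      then show ?thesis by simp
    qed
    also have "\<dots> = ennreal ((\<Sum>d\<in>D. measure (distr \<mu> borel (ifs_map M d)) A) / real (card D))"
      using D by (subst sum_ennreal)
        (auto simp: divide_ennreal ennreal_of_nat_eq_real_of_nat card_gt_0_iff sum_nonneg)
    also have "\<dots> = emeasure \<mu> A"
      using \<mu> A by (auto simp: is_self_affine_measure_def emeasure_eq_measure)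
    finally show "emeasure \<mu> A = emeasure (distr ?P borel (\<lambda>(d, x). ifs_map M d x)) A" by simp
  qed
qed

text \<open>Boundedness makes the integrand integrable on the product, so Fubini splits the
  pushforward formula into a finite average over digits. Used for real test functions and for
  exponentials.\<close>

lemma integral_self_affine:
  fixes M :: "real^'n^'n" and f :: "real^'n \<Rightarrow> 'b::{banach, second_countable_topology}"
  assumes \<mu>: "is_self_affine_measure M D \<mu>" and D: "finite D" "D \<noteq> {}"
    and f [measurable]: "f \<in> borel_measurable borel" and bound: "\<And>x. norm (f x) \<le> C"
  shows "(\<integral>x. f x \<partial>\<mu>) = (1 / real (card D)) *\<^sub>R (\<Sum>d\<in>D. \<integral>x. f (ifs_map M d x) \<partial>\<mu>)"
proof -
  interpret prob_space \<mu> using \<mu> by (rule self_affine_prob_space)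
  have [measurable_cong]: "sets \<mu> = sets borel"
    using \<mu> by (simp add: is_self_affine_measure_def)
  let ?p = "measure_pmf (pmf_of_set D)"
  interpret P: pair_prob_space ?p \<mu> ..
  have id: "(\<lambda>d. d) \<in> ?p \<rightarrow>\<^sub>M (borel :: (real^'n) measure)"
    by simp
  have [measurable]: "fst \<in> borel_measurable (?p \<Otimes>\<^sub>M \<mu>)"
    by (rule measurable_compose[OF measurable_fst id])
  have m [measurable]: "(\<lambda>(d, x). ifs_map M d x) \<in> borel_measurable (?p \<Otimes>\<^sub>M \<mu>)"
    unfolding ifs_map_def case_prod_beta by measurable
  have "(\<integral>x. f x \<partial>\<mu>) = (\<integral>x. f x \<partial>distr (?p \<Otimes>\<^sub>M \<mu>) borel (\<lambda>(d, x). ifs_map M d x))"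
    using self_affine_eq_distr[OF \<mu> D] by simp
  also have "\<dots> = (\<integral>z. f ((\<lambda>(d, x). ifs_map M d x) z) \<partial>(?p \<Otimes>\<^sub>M \<mu>))"
    by (rule integral_distr) measurable
  also have "\<dots> = (\<integral>d. \<integral>x. f (ifs_map M d x) \<partial>\<mu> \<partial>?p)"
  proof -
    have "integrable (?p \<Otimes>\<^sub>M \<mu>) (\<lambda>z. f ((\<lambda>(d, x). ifs_map M d x) z))"
      by (rule P.integrable_const_bound[where B=C]) (auto simp: bound)
    from P.integral_fst'[OF this] show ?thesis by simp
  qed
  also have "\<dots> = (\<Sum>d\<in>D. pmf (pmf_of_set D) d *\<^sub>R (\<integral>x. f (ifs_map M d x) \<partial>\<mu>))"
    using D by (intro integral_measure_pmf) auto
  also have "\<dots> = (1 / real (card D)) *\<^sub>R (\<Sum>d\<in>D. \<integral>x. f (ifs_map M d x) \<partial>\<mu>)"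
    using D by (simp add: scaleR_sum_right)
  finally show ?thesis .
qed

section \<open>Uniqueness of the self-affine measure\<close>

text \<open>The digit cancels in \<open>ifs_map M d x - ifs_map M d y\<close>, so composing
  \<open>f\<close> with a map of the system replaces the modulus \<psi> by \<psi> after
  \<open>matrix_inv M\<close>. Each use of self-affinity therefore contracts the argument of \<psi>
  once more; the induction has to vary \<open>f\<close> and \<psi> together.\<close>

lemma integral_diff_bound_self_affine:
  fixes M :: "real^'n^'n" and f \<psi> :: "real^'n \<Rightarrow> real"
  assumes \<mu>: "is_self_affine_measure M D \<mu>" and \<nu>: "is_self_affine_measure M D \<nu>"
    and D: "finite D" "D \<noteq> {}"
    and f: "f \<in> borel_measurable borel" and bound: "\<And>x. \<bar>f x\<bar> \<le> C"
    and \<psi>: "\<psi> \<in> borel_measurable borel" and \<psi>b: "\<And>x. \<bar>\<psi> x\<bar> \<le> C'"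
    and modulus: "\<And>x y. \<bar>f x - f y\<bar> \<le> \<psi> (x - y)"
  shows "\<bar>(\<integral>x. f x \<partial>\<mu>) - (\<integral>x. f x \<partial>\<nu>)\<bar>
    \<le> (\<integral>x. \<psi> ((((*v) (matrix_inv M)) ^^ k) x) \<partial>\<mu>) + (\<integral>x. \<psi> ((((*v) (matrix_inv M)) ^^ k) x) \<partial>\<nu>)"
  using f bound \<psi> \<psi>b modulus
proof (induction k arbitrary: f \<psi>)
  case 0
  \<comment> \<open>Both integrals are compared with the common value \<open>f 0\<close>.\<close>
  have *: "\<bar>(\<integral>x. f x \<partial>\<kappa>) - f 0\<bar> \<le> (\<integral>x. \<psi> x \<partial>\<kappa>)"
    if \<kappa>: "is_self_affine_measure M D \<kappa>" for \<kappa>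
  proof -
    interpret prob_space \<kappa> using \<kappa> by (rule self_affine_prob_space)
    have [measurable_cong]: "sets \<kappa> = sets borel"
      using \<kappa> by (simp add: is_self_affine_measure_def)
    note [measurable] = 0(1,3)
    have i: "integrable \<kappa> f" "integrable \<kappa> \<psi>"
      using 0 by (auto intro!: integrable_const_bound[where B=C and f=f] integrable_const_bound[where B=C' and f=\<psi>])
    have "(\<integral>x. f x \<partial>\<kappa>) - f 0 = (\<integral>x. f x - f 0 \<partial>\<kappa>)"
      using i by (simp add: prob_space)
    also have "\<bar>\<dots>\<bar> \<le> (\<integral>x. \<bar>f x - f 0\<bar> \<partial>\<kappa>)" by (rule integral_abs_bound)
    also have "\<dots> \<le> (\<integral>x. \<psi> x \<partial>\<kappa>)"
      using i 0(5)[of _ 0] by (intro integral_mono) auto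
    finally show ?thesis .
  qed
  show ?case using *[OF \<mu>] *[OF \<nu>] by simp
next
  case (Suc k)
  let ?B = "matrix_inv M"
  let ?R = "(\<integral>x. \<psi> ((((*v) ?B) ^^ Suc k) x) \<partial>\<mu>) + (\<integral>x. \<psi> ((((*v) ?B) ^^ Suc k) x) \<partial>\<nu>)"
  note [measurable] = Suc.prems(1,3)
  have step: "\<bar>(\<integral>x. f (ifs_map M d x) \<partial>\<mu>) - (\<integral>x. f (ifs_map M d x) \<partial>\<nu>)\<bar> \<le> ?R" for d
  proof -
    have "\<bar>f (ifs_map M d x) - f (ifs_map M d y)\<bar> \<le> \<psi> (?B *v (x - y))" for x y
      using Suc.prems(5)[of "ifs_map M d x" "ifs_map M d y"]
      by (simp add: ifs_map_def matrix_vector_mult_diff_distrib matrix_vector_right_distrib)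
    then show ?thesis
      using Suc.IH[of "\<lambda>x. f (ifs_map M d x)" "\<lambda>x. \<psi> (?B *v x)"] Suc.prems(2,4) by simp
  qed
  have "\<bar>(\<integral>x. f x \<partial>\<mu>) - (\<integral>x. f x \<partial>\<nu>)\<bar> =
      \<bar>\<Sum>d\<in>D. (\<integral>x. f (ifs_map M d x) \<partial>\<mu>) - (\<integral>x. f (ifs_map M d x) \<partial>\<nu>)\<bar> / card D"
    using Suc.prems(2)
    by (simp add: integral_self_affine[OF \<mu> D, of f C] integral_self_affine[OF \<nu> D, of f C]
        sum_subtractf flip: diff_divide_distrib)
  also have "\<dots> \<le> (\<Sum>d\<in>D. ?R) / card D"
    by (intro divide_right_mono order_trans[OF sum_abs] sum_mono step) auto
  also have "\<dots> = ?R" using D by simp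
  finally show ?case .
qed

text \<open>For a bounded Lipschitz function the previous bound tends to 0 by dominated convergence.
  Such functions approximate indicators of closed sets, and closed sets form an intersection-stable
  generator of the Borel sets.\<close>

lemma self_affine_measure_unique:
  fixes M :: "real^'n^'n"
  assumes \<mu>: "is_self_affine_measure M D \<mu>" and \<nu>: "is_self_affine_measure M D \<nu>"
    and D: "finite D" "D \<noteq> {}"
    and lim: "\<And>x. (\<lambda>k. (((*v) (matrix_inv M)) ^^ k) x) \<longlonglongrightarrow> 0"
  shows "\<mu> = \<nu>"
proof -
  have s: "sets \<kappa> = sets borel" "space \<kappa> = UNIV" "prob_space \<kappa>"
    if \<kappa>: "is_self_affine_measure M D \<kappa>" for \<kappa>
  proof -
    show "sets \<kappa> = sets borel" using \<kappa> by (simp add: is_self_affine_measure_def)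
    then show "space \<kappa> = UNIV" by (metis sets_eq_imp_space_eq space_borel)
  qed (rule self_affine_prob_space[OF \<kappa>])
  note [measurable_cong] = s(1)[OF \<mu>] s(1)[OF \<nu>]
  interpret \<mu>: prob_space \<mu> by (rule s(3)[OF \<mu>])
  interpret \<nu>: prob_space \<nu> by (rule s(3)[OF \<nu>])
  have pow [measurable]: "(((*v) (matrix_inv M)) ^^ k) \<in> borel_measurable borel" for k
    by (induction k) (auto intro!: measurable_comp[OF _ measurable_matrix_vector_mult] simp: id_def)
  have eq_int: "(\<integral>x. f x \<partial>\<mu>) = (\<integral>x. f x \<partial>\<nu>)"
    if f [measurable]: "f \<in> borel_measurable borel" and b: "\<And>x. 0 \<le> f x \<and> f x \<le> 1"
      and L: "\<And>x y. \<bar>f x - f y\<bar> \<le> L * norm (x - y)" and "L \<ge> 0" for f :: "real^'n \<Rightarrow> real" and L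
  proof -
    \<comment> \<open>Since \<open>f\<close> takes values in [0,1], the Lipschitz modulus may be cut
      off at 1; the constant 1 then dominates without any moment bound on the measures.\<close>
    define \<psi> :: "real^'n \<Rightarrow> real" where "\<psi> x = min 1 (L * norm x)" for x
    have [measurable]: "\<psi> \<in> borel_measurable borel" unfolding \<psi>_def by measurable
    have \<psi>b: "\<bar>\<psi> x\<bar> \<le> 1" for x using \<open>L \<ge> 0\<close> by (auto simp: \<psi>_def)
    have \<psi>m: "\<bar>f x - f y\<bar> \<le> \<psi> (x - y)" for x y
      using L[of x y] b[of x] b[of y] by (auto simp: \<psi>_def)
    have "(\<lambda>k. \<psi> ((((*v) (matrix_inv M)) ^^ k) x)) \<longlonglongrightarrow> min 1 (L * norm (0::real^'n))" for x
      unfolding \<psi>_def by (intro tendsto_intros lim)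
    then have pt: "(\<lambda>k. \<psi> ((((*v) (matrix_inv M)) ^^ k) x)) \<longlonglongrightarrow> 0" for x by simp
    have "(\<lambda>k. \<integral>x. \<psi> ((((*v) (matrix_inv M)) ^^ k) x) \<partial>\<mu>) \<longlonglongrightarrow> (\<integral>x. 0 \<partial>\<mu>)"
      by (rule integral_dominated_convergence[where w="\<lambda>_. 1"]) (auto simp: \<psi>b pt)
    moreover have "(\<lambda>k. \<integral>x. \<psi> ((((*v) (matrix_inv M)) ^^ k) x) \<partial>\<nu>) \<longlonglongrightarrow> (\<integral>x. 0 \<partial>\<nu>)"
      by (rule integral_dominated_convergence[where w="\<lambda>_. 1"]) (auto simp: \<psi>b pt)
    ultimately have "(\<lambda>k. (\<integral>x. \<psi> ((((*v) (matrix_inv M)) ^^ k) x) \<partial>\<mu>)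
        + (\<integral>x. \<psi> ((((*v) (matrix_inv M)) ^^ k) x) \<partial>\<nu>)) \<longlonglongrightarrow> 0"
      using tendsto_add by fastforce
    then have "\<bar>(\<integral>x. f x \<partial>\<mu>) - (\<integral>x. f x \<partial>\<nu>)\<bar> \<le> 0"
      by (rule LIMSEQ_le_const)
        (use integral_diff_bound_self_affine[OF \<mu> \<nu> D, of f 1 \<psi> 1] b \<psi>b \<psi>m in auto)
    then show ?thesis by simp
  qed
  \<comment> \<open>The empty set is treated separately because \<open>infdist\<close> to it is 0 by
    convention.\<close>
  have closed_eq: "measure \<mu> A = measure \<nu> A" if A: "closed A" "A \<noteq> {}" for A
  proof -
    define f where "f n x = max 0 (1 - real n * infdist x A)" for n :: nat and x
    have [measurable]: "f n \<in> borel_measurable borel" for n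
      unfolding f_def
      by (intro borel_measurable_continuous_onI continuous_intros continuous_on_infdist)
    have [measurable]: "A \<in> sets borel" using A by simp
    have L: "\<bar>f n x - f n y\<bar> \<le> real n * norm (x - y)" for n x y
    proof -
      have "\<bar>infdist x A - infdist y A\<bar> \<le> norm (x - y)"
        using infdist_triangle_abs[of x A y] by (simp add: dist_norm)
      then have "real n * \<bar>infdist x A - infdist y A\<bar> \<le> real n * norm (x - y)"
        by (rule mult_left_mono) simp
      then have "\<bar>real n * infdist x A - real n * infdist y A\<bar> \<le> real n * norm (x - y)"
        by (simp add: abs_mult flip: right_diff_distrib)
      then show ?thesis by (auto simp: f_def)
    qed
    have b: "0 \<le> f n x \<and> f n x \<le> 1" for n x
      by (auto simp: f_def infdist_nonneg)
    have pt: "(\<lambda>n. f n x) \<longlonglongrightarrow> indicator A x" for x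
    proof (cases "x \<in> A")
      case True
      then show ?thesis by (simp add: f_def)
    next
      case False
      then have pos: "infdist x A > 0"
        using A by (metis in_closed_iff_infdist_zero infdist_nonneg less_le)
      have "f n x = 0" if "n \<ge> nat \<lceil>1 / infdist x A\<rceil>" for n
      proof -
        have "1 / infdist x A \<le> real n" using that by linarith
        then show ?thesis using pos by (simp add: f_def field_simps)
      qed
      then have "eventually (\<lambda>n. f n x = 0) sequentially"
        by (rule eventually_sequentiallyI)
      then show ?thesis using False by (simp add: tendsto_eventually)
    qed
    have "(\<lambda>n. \<integral>x. f n x \<partial>\<mu>) \<longlonglongrightarrow> (\<integral>x. indicator A x \<partial>\<mu>)"
      by (rule integral_dominated_convergence[where w="\<lambda>_. 1"]) (use b pt in auto)
    moreover have "(\<lambda>n. \<integral>x. f n x \<partial>\<nu>) \<longlonglongrightarrow> (\<integral>x. indicator A x \<partial>\<nu>)"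
      by (rule integral_dominated_convergence[where w="\<lambda>_. 1"]) (use b pt in auto)
    moreover have "(\<integral>x. f n x \<partial>\<mu>) = (\<integral>x. f n x \<partial>\<nu>)" for n
      using eq_int[of "f n" "real n"] b L by simp
    ultimately have "(\<integral>x. indicator A x \<partial>\<mu>) = (\<integral>x. indicator A x \<partial>\<nu> :: real)"
      using LIMSEQ_unique by auto
    then show ?thesis by (simp add: s[OF \<mu>] s[OF \<nu>])
  qed
  show ?thesis
  proof (rule measure_eqI_generator_eq[where E="Collect closed" and \<Omega>=UNIV and A="\<lambda>_. UNIV"])
    show "Int_stable (Collect closed :: (real^'n) set set)" by (auto simp: Int_stable_def)
    fix X :: "(real^'n) set" assume "X \<in> Collect closed"
    then show "emeasure \<mu> X = emeasure \<nu> X"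
      using closed_eq[of X] by (cases "X = {}") (auto simp: \<mu>.emeasure_eq_measure \<nu>.emeasure_eq_measure)
  qed (auto simp: s(1)[OF \<mu>] s(1)[OF \<nu>] borel_eq_closed)
qed

section \<open>Existence of the self-affine measure\<close>

lemma self_affine_measure_exists:
  fixes M :: "real^'n^'n"
  assumes D: "finite D" "D \<noteq> {}"
    and sum: "\<And>x. summable (\<lambda>k. norm ((((*v) (matrix_inv M)) ^^ k) x))"
  shows "\<exists>\<mu>. is_self_affine_measure M D \<mu>"
proof -
  define B where "B = matrix_inv M"
  obtain d0 where d0: "d0 \<in> D" using D by auto
  \<comment> \<open>Streams range over all sequences of vectors; sending vectors outside
    \<open>D\<close> to \<open>d0\<close> makes the series converge for every stream, not just
    almost surely.\<close>
  define g where "g d = (if d \<in> D then d else d0)" for d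
  have gD: "g d \<in> D" for d using d0 by (simp add: g_def)
  define p where "p = measure_pmf (pmf_of_set D)"
  interpret p: prob_space p unfolding p_def by unfold_locales
  let ?S = "stream_space p"
  interpret S: prob_space ?S by (rule p.prob_space_stream_space)
  have spS: "space ?S = UNIV" by (simp add: space_stream_space p_def)
  \<comment> \<open>The measure is the law of the random series with independent uniform digits.\<close>
  define X where "X \<omega> = (\<Sum>k. (((*v) B) ^^ Suc k) (g (\<omega> !! k)))" for \<omega>
  have sumX: "summable (\<lambda>k. (((*v) B) ^^ Suc k) (g (\<omega> !! k)))" for \<omega>
  proof (rule summable_norm_cancel, rule summable_comparison_test')
    \<comment> \<open>Summing over all digits gives a majorant that does not depend on the
      stream.\<close>
    show "summable (\<lambda>k. \<Sum>d\<in>D. norm ((((*v) B) ^^ Suc k) d))"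
    proof (rule summable_sum)
      fix d
      show "summable (\<lambda>k. norm ((((*v) B) ^^ Suc k) d))"
        using sum[of d] unfolding B_def by (subst summable_Suc_iff)
    qed
    show "norm (norm ((((*v) B) ^^ Suc k) (g (\<omega> !! k)))) \<le> (\<Sum>d\<in>D. norm ((((*v) B) ^^ Suc k) d))" for k
      using member_le_sum[of "g (\<omega> !! k)" D "\<lambda>d. norm ((((*v) B) ^^ Suc k) d)"] gD D by simp
  qed
  \<comment> \<open>Prepending a digit amounts to applying its map. Conditioning on the first digit
    then yields self-affinity.\<close>
  have X_Stream: "X (d ## \<omega>) = ifs_map M d (X \<omega>)" if "d \<in> D" for d \<omega>
  proof -
    have "X (d ## \<omega>) = B *v g d + (\<Sum>k. (((*v) B) ^^ Suc (Suc k)) (g (\<omega> !! k)))"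
      using suminf_split_head[OF sumX[of "d ## \<omega>"]] unfolding X_def by (simp add: algebra_simps)
    also have "(\<Sum>k. (((*v) B) ^^ Suc (Suc k)) (g (\<omega> !! k))) = B *v X \<omega>"
      using bounded_linear.suminf[OF matrix_vector_mul_bounded_linear[of B] sumX[of \<omega>]]
      unfolding X_def by simp
    finally show ?thesis
      using that by (simp add: ifs_map_def B_def[symmetric] g_def matrix_vector_right_distrib add.commute)
  qed
  have X [measurable]: "X \<in> borel_measurable ?S"
    unfolding X_def
  proof (rule borel_measurable_suminf)
    fix k
    have "(\<lambda>d. (((*v) B) ^^ Suc k) (g d)) \<in> borel_measurable p" by (simp add: p_def)
    then show "(\<lambda>\<omega>. (((*v) B) ^^ Suc k) (g (\<omega> !! k))) \<in> borel_measurable ?S"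
      by (rule measurable_compose[OF measurable_snth])
  qed
  have "is_self_affine_measure M D (distr ?S borel X)"
    unfolding is_self_affine_measure_def
  proof (intro conjI ballI)
    show "emeasure (distr ?S borel X) UNIV = 1"
      using S.emeasure_space_1 by (simp add: emeasure_distr spS)
    fix A :: "(real^'n) set" assume A [measurable]: "A \<in> sets borel"
    have XA: "X -` A \<in> sets ?S" using measurable_sets[OF X A] by (simp add: spS)
    have "emeasure (distr ?S borel X) A = emeasure ?S (X -` A)"
      by (simp add: emeasure_distr spS)
    also have "\<dots> = (\<integral>\<^sup>+d. emeasure ?S {\<omega>. X (d ## \<omega>) \<in> A} \<partial>p)"
      using XA by (subst p.emeasure_stream_space) (auto simp: spS)
    also have "\<dots> = (\<Sum>d\<in>D. emeasure ?S {\<omega>. X (d ## \<omega>) \<in> A}) / card D"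
      unfolding p_def by (subst nn_integral_pmf_of_set) (use D in auto)
    also have "\<dots> = (\<Sum>d\<in>D. ennreal (measure (distr (distr ?S borel X) borel (ifs_map M d)) A)) / card D"
    proof -
      have "emeasure ?S {\<omega>. X (d ## \<omega>) \<in> A} = ennreal (measure (distr (distr ?S borel X) borel (ifs_map M d)) A)"
        if "d \<in> D" for d
      proof -
        have "measure (distr (distr ?S borel X) borel (ifs_map M d)) A
          = measure ?S {\<omega>. ifs_map M d (X \<omega>) \<in> A}"
          by (subst distr_distr) (auto simp: measure_distr spS vimage_def)
        then show ?thesis by (simp add: X_Stream[OF that] S.emeasure_eq_measure)
      qed
      then show ?thesis by simp
    qed
    also have "\<dots> = ennreal ((\<Sum>d\<in>D. measure (distr (distr ?S borel X) borel (ifs_map M d)) A) / real (card D))"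
      using D by (subst sum_ennreal)
        (auto simp: divide_ennreal ennreal_of_nat_eq_real_of_nat card_gt_0_iff sum_nonneg)
    finally have "measure (distr ?S borel X) A
        = (\<Sum>d\<in>D. measure (distr (distr ?S borel X) borel (ifs_map M d)) A) / real (card D)"
      by (intro measure_eq_emeasure_eq_ennreal divide_nonneg_nonneg sum_nonneg) auto
    then show "measure (distr ?S borel X) A =
        1 / real (card D) * (\<Sum>d\<in>D. measure (distr (distr ?S borel X) borel (ifs_map M d)) A)"
      by simp
  qed simp
  then show ?thesis by blast
qed

text \<open>Summability of the backward orbits yields existence, and their convergence to 0 yields
  uniqueness, so the definite description denotes.\<close>

lemma self_affine_measure_is_self_affine:
  fixes M :: "real^'n^'n"
  assumes D: "finite D" "D \<noteq> {}"
    and sum: "\<And>x. summable (\<lambda>k. norm ((((*v) (matrix_inv M)) ^^ k) x))"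
  shows "is_self_affine_measure M D (self_affine_measure M D)"
  unfolding self_affine_measure_def
proof (rule theI')
  have "(\<lambda>k. (((*v) (matrix_inv M)) ^^ k) x) \<longlonglongrightarrow> 0" for x
    using summable_LIMSEQ_zero[OF sum] by (rule tendsto_norm_zero_cancel)
  then show "\<exists>!\<mu>. is_self_affine_measure M D \<mu>"
    using self_affine_measure_exists[OF D sum] self_affine_measure_unique[OF _ _ D] by blast
qed

section \<open>The Fourier transform and its zeros\<close>

definition fourier :: "(real^'n) measure \<Rightarrow> real^'n \<Rightarrow> complex" where
  "fourier \<mu> \<xi> = (\<integral>x. expo \<xi> x \<partial>\<mu>)"

lemma norm_expo [simp]: "norm (expo l x) = 1"
proof -
  have "expo l x = exp (\<i> * of_real (2 * pi * (l \<bullet> x)))" by (simp add: expo_def algebra_simps)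
  then show ?thesis by (metis norm_exp_i_times)
qed

lemma expo_commute: "expo l x = expo x l"
  by (simp add: expo_def inner_commute)

lemma expo_add_right: "expo l (x + y) = expo l x * expo l y"
  by (simp add: expo_def inner_add_right algebra_simps exp_add)

lemma expo_matrix: "expo l (A *v x) = expo (transpose A *v l) x"
  by (simp add: expo_def transpose_matrix_vector dot_lmul_matrix)

lemma measurable_expo [measurable]: "expo l \<in> borel_measurable borel"
  unfolding expo_def by (intro borel_measurable_continuous_onI continuous_intros)

lemma L2_inner_expo: "L2_inner \<mu> (expo l) (expo l') = fourier \<mu> (l - l')"
proof -
  have "expo l x * cnj (expo l' x) = expo (l - l') x" for x
  proof -
    have "expo l x * cnj (expo l' x) = exp (2 * of_real pi * \<i> * of_real (l \<bullet> x) - 2 * of_real pi * \<i> * of_real (l' \<bullet> x))"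
      by (simp add: expo_def exp_cnj exp_diff exp_minus divide_inverse)
    then show ?thesis by (simp add: expo_def inner_diff_left right_diff_distrib)
  qed
  then show ?thesis by (simp add: L2_inner_def fourier_def)
qed

text \<open>A character evaluated at \<open>ifs_map M d x\<close> splits into a factor depending on
  \<open>d\<close> and a factor depending on \<open>x\<close>; averaging the former over
  \<open>D\<close> gives the mask polynomial.\<close>

lemma fourier_self_affine:
  fixes M :: "real^'n^'n"
  assumes \<mu>: "is_self_affine_measure M D \<mu>" and D: "finite D" "D \<noteq> {}"
  defines "T \<equiv> (*v) (transpose (matrix_inv M))"
  shows "fourier \<mu> \<xi> = mask_poly D (T \<xi>) * fourier \<mu> (T \<xi>)"
proof -
  have "expo \<xi> (ifs_map M d x) = expo d (T \<xi>) * expo (T \<xi>) x" for d x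
    by (simp add: ifs_map_def expo_matrix expo_add_right T_def expo_commute[of _ d])
  then have "fourier \<mu> \<xi> = (1 / real (card D)) *\<^sub>R (\<Sum>d\<in>D. expo d (T \<xi>) * fourier \<mu> (T \<xi>))"
    unfolding fourier_def
    by (subst integral_self_affine[OF \<mu> D, where C=1]) auto
  then show ?thesis
    by (simp add: mask_poly_def sum_distrib_right scaleR_conv_of_real)
qed

lemma fourier_self_affine_pow:
  fixes M :: "real^'n^'n"
  assumes \<mu>: "is_self_affine_measure M D \<mu>" and D: "finite D" "D \<noteq> {}"
  defines "T \<equiv> (*v) (transpose (matrix_inv M))"
  shows "fourier \<mu> \<xi> = (\<Prod>j<k. mask_poly D ((T ^^ Suc j) \<xi>)) * fourier \<mu> ((T ^^ k) \<xi>)"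
proof (induction k)
  case (Suc k)
  then show ?case
    using fourier_self_affine[OF \<mu> D, of "(T ^^ k) \<xi>", folded T_def] by simp
qed simp

lemma expo_funpow_matrix:
  fixes A :: "real^'n^'n"
  shows "expo l ((((*v) A) ^^ k) x) = expo ((((*v) (transpose A)) ^^ k) l) x"
proof (induction k arbitrary: l)
  case (Suc k)
  have "expo l ((((*v) A) ^^ Suc k) x) = expo (transpose A *v l) ((((*v) A) ^^ k) x)"
    by (simp add: expo_matrix)
  also have "\<dots> = expo ((((*v) (transpose A)) ^^ Suc k) l) x"
    unfolding Suc by (simp add: funpow_swap1)
  finally show ?case .
qed simp

text \<open>In the finite product formula the tail factor tends to the total mass 1, hence is
  nonzero for some \<open>k\<close>. A zero of the transform must then come from one of the finitely
  many mask factors.\<close>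

lemma fourier_eq_0_iff:
  fixes M :: "real^'n^'n"
  assumes \<mu>: "is_self_affine_measure M D \<mu>" and D: "finite D" "D \<noteq> {}"
    and lim: "\<And>x. (\<lambda>k. (((*v) (matrix_inv M)) ^^ k) x) \<longlonglongrightarrow> 0"
  defines "T \<equiv> (*v) (transpose (matrix_inv M))"
  shows "fourier \<mu> \<xi> = 0 \<longleftrightarrow> (\<exists>k. mask_poly D ((T ^^ Suc k) \<xi>) = 0)"
proof
  assume "\<exists>k. mask_poly D ((T ^^ Suc k) \<xi>) = 0"
  then obtain k where "mask_poly D ((T ^^ Suc k) \<xi>) = 0" ..
  then show "fourier \<mu> \<xi> = 0"
    using fourier_self_affine_pow[OF \<mu> D, of \<xi> "Suc k"] by (auto simp: T_def)
next
  interpret prob_space \<mu> using \<mu> by (rule self_affine_prob_space)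
  have [measurable_cong]: "sets \<mu> = sets borel"
    using \<mu> by (simp add: is_self_affine_measure_def)
  assume 0: "fourier \<mu> \<xi> = 0"
  have "(\<lambda>k. \<integral>x. expo ((T ^^ k) \<xi>) x \<partial>\<mu>) \<longlonglongrightarrow> (\<integral>x. 1 \<partial>\<mu>)"
  proof (rule integral_dominated_convergence[where w="\<lambda>_. 1"])
    \<comment> \<open>The powers act on the point \<open>x\<close>, where \<open>lim\<close>
      applies; \<open>expo_funpow_matrix\<close> then moves them to the frequency.\<close>
    have "(\<lambda>k. expo \<xi> ((((*v) (matrix_inv M)) ^^ k) x)) \<longlonglongrightarrow> exp (2 * of_real pi * \<i> * of_real (\<xi> \<bullet> 0))" for x
      unfolding expo_def by (intro tendsto_intros lim)
    then have "(\<lambda>k. expo ((T ^^ k) \<xi>) x) \<longlonglongrightarrow> 1" for x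
      by (simp add: expo_funpow_matrix T_def)
    then show "AE x in \<mu>. (\<lambda>k. expo ((T ^^ k) \<xi>) x) \<longlonglongrightarrow> 1" by simp
  qed auto
  then have "(\<lambda>k. fourier \<mu> ((T ^^ k) \<xi>)) \<longlonglongrightarrow> 1"
    by (simp add: fourier_def prob_space)
  then have "eventually (\<lambda>k. fourier \<mu> ((T ^^ k) \<xi>) \<noteq> 0) sequentially"
    by (rule tendsto_imp_eventually_ne) simp
  then obtain k where "fourier \<mu> ((T ^^ k) \<xi>) \<noteq> 0"
    by (meson eventually_happens trivial_limit_sequentially)
  then have "(\<Prod>j<k. mask_poly D ((T ^^ Suc j) \<xi>)) = 0"
    using 0 fourier_self_affine_pow[OF \<mu> D, of \<xi> k] by (auto simp: T_def)
  then show "\<exists>k. mask_poly D ((T ^^ Suc k) \<xi>) = 0" by auto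
qed

section \<open>Expanding matrices in dimension two\<close>

text \<open>A root makes the complex matrix \<open>M - c\<close> singular, and a kernel vector is an
  eigenvector. This turns \<open>expanding\<close> into a statement on the roots of the
  characteristic polynomial.\<close>

lemma eigenvalue_of_charpoly_root:
  fixes M :: "real^2^2"
  assumes "c\<^sup>2 - of_real (M$1$1 + M$2$2) * c + of_real (det M) = 0"
  shows "eigenvalue_of M c"
proof -
  define N :: "complex^2^2" where "N = map_matrix complex_of_real M - mat c"
  have "det N = c\<^sup>2 - of_real (M$1$1 + M$2$2) * c + of_real (det M)"
    by (simp add: det_2 N_def mat_def power2_eq_square algebra_simps)
  then have "\<not> invertible N" using assms by (simp add: invertible_det_nz)
  then obtain v where v: "N *v v = 0" "v \<noteq> 0"
    unfolding invertible_left_inverse matrix_left_invertible_ker by auto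
  have "mat c *v v = c *s v"
    by (simp add: vec_eq_iff forall_2 matrix_vector_mult_def mat_def sum_2)
  then have "map_matrix complex_of_real M *v v = c *s v"
    using v(1) by (simp add: N_def matrix_vector_mult_diff_rdistrib)
  then show ?thesis using v(2) unfolding eigenvalue_of_def by blast
qed

lemma charpoly_roots:
  fixes t d :: complex
  obtains a b where "a + b = t" "a * b = d" "a\<^sup>2 - t * a + d = 0" "b\<^sup>2 - t * b + d = 0"
proof -
  define s where "s = csqrt (t\<^sup>2 - 4 * d)"
  have s: "s\<^sup>2 = t\<^sup>2 - 4 * d" by (simp add: s_def)
  show ?thesis
  proof
    show "(t + s) / 2 + (t - s) / 2 = t" by (simp add: field_simps)
    show "(t + s) / 2 * ((t - s) / 2) = d"
      using s by (simp add: power2_eq_square square_diff_square_factored[symmetric])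
    show "((t + s) / 2)\<^sup>2 - t * ((t + s) / 2) + d = 0"
      using s by (simp add: power_divide power2_sum) (simp add: field_simps power2_eq_square)
    show "((t - s) / 2)\<^sup>2 - t * ((t - s) / 2) + d = 0"
      using s by (simp add: power_divide power2_diff) (simp add: field_simps power2_eq_square)
  qed
qed

text \<open>The recurrence has characteristic roots 1/a and 1/b, both inside the unit disc. Removing
  one root at a time also covers the case a = b, where no basis of geometric sequences
  exists.\<close>

lemma summable_of_recurrence:
  fixes f :: "nat \<Rightarrow> complex"
  assumes a: "norm a > 1" and b: "norm b > 1"
    and rec: "\<And>k. f k = (a + b) * f (Suc k) - a * b * f (Suc (Suc k))"
  shows "summable (\<lambda>k. norm (f k))"
proof -
  \<comment> \<open>Splitting off the root $a$ leaves a geometric sequence of ratio $1/b$.\<close>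
  define g where "g k = f k - a * f (Suc k)" for k
  have nz: "a \<noteq> 0" "b \<noteq> 0" using a b by auto
  have g: "g (Suc k) = g k / b" for k
    using rec[of k] nz by (simp add: g_def field_simps)
  have sg: "summable (\<lambda>k. norm (g k))"
  proof (rule summable_ratio_test[where N=0])
    show "1 / norm b < 1" using b by (subst divide_less_eq_1_pos) linarith+
  qed (auto simp: g norm_divide)
  \<comment> \<open>What remains is a contraction of ratio 1/|a| with a summable
    perturbation.\<close>
  have fS: "norm (f (Suc k)) \<le> 1 / norm a * norm (f k) + norm (g k)" for k
  proof -
    have "f (Suc k) = (f k - g k) / a" using nz by (simp add: g_def)
    then have "norm (f (Suc k)) \<le> norm (f k) / norm a + norm (g k) / norm a"
      using norm_triangle_ineq4[of "f k" "g k"] a by (simp add: norm_divide divide_right_mono flip: add_divide_distrib)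
    also have "norm (g k) / norm a \<le> norm (g k)"
      using a mult_left_mono[of 1 "norm a" "norm (g k)"] by (subst pos_divide_le_eq) auto
    finally show ?thesis by simp
  qed
  define c where "c = 1 / norm a"
  have c: "0 \<le> c" "c < 1"
    unfolding c_def using a by (simp, subst divide_less_eq_1_pos) linarith+
  \<comment> \<open>Summing the contraction inequality bounds a partial sum by a constant plus
    \<open>c\<close> times itself; as \<open>c < 1\<close>, it can be solved for the partial
    sum.\<close>
  have "(\<Sum>k<n. norm (f k)) \<le> (norm (f 0) + (\<Sum>k. norm (g k))) / (1 - c)" for n
  proof -
    have "(\<Sum>k<Suc n. norm (f k)) = norm (f 0) + (\<Sum>k<n. norm (f (Suc k)))"
      by (rule sum.lessThan_Suc_shift)
    also have "(\<Sum>k<n. norm (f (Suc k))) \<le> (\<Sum>k<n. c * norm (f k) + norm (g k))"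
      using fS by (intro sum_mono) (simp add: c_def)
    also have "\<dots> = c * (\<Sum>k<n. norm (f k)) + (\<Sum>k<n. norm (g k))"
      by (simp add: sum.distrib sum_distrib_left)
    also have "(\<Sum>k<n. norm (g k)) \<le> (\<Sum>k. norm (g k))"
      by (rule sum_le_suminf[OF sg]) auto
    finally have "(\<Sum>k<Suc n. norm (f k)) \<le> norm (f 0) + (c * (\<Sum>k<n. norm (f k)) + (\<Sum>k. norm (g k)))"
      by simp
    moreover have "(\<Sum>k<n. norm (f k)) \<le> (\<Sum>k<Suc n. norm (f k))" by simp
    ultimately have "(\<Sum>k<n. norm (f k)) * (1 - c) \<le> norm (f 0) + (\<Sum>k. norm (g k))"
      unfolding right_diff_distrib mult.commute[of _ c] by linarith
    then show ?thesis using c by (simp add: pos_le_divide_eq)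
  qed
  then have "(\<Sum>k\<le>n. norm (f k)) \<le> (norm (f 0) + (\<Sum>k. norm (g k))) / (1 - c)" for n
    unfolding lessThan_Suc_atMost[symmetric] .
  then show ?thesis
    by (rule bounded_imp_summable[OF norm_ge_zero])
qed

lemma expanding_det_nonzero:
  fixes M :: "real^2^2"
  assumes "expanding M"
  shows "det M \<noteq> 0"
  using assms eigenvalue_of_charpoly_root[of 0 M] by (auto simp: expanding_def)

lemma matrix_mult_inv_cancel:
  fixes M :: "real^'n^'n"
  assumes "det M \<noteq> 0"
  shows "M *v (matrix_inv M *v x) = x" "matrix_inv M *v (M *v x) = x"
    "transpose M *v (transpose (matrix_inv M) *v x) = x"
    "transpose (matrix_inv M) *v (transpose M *v x) = x"
proof -
  have "invertible M" using assms by (simp add: invertible_det_nz)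
  then have *: "M ** matrix_inv M = mat 1" "matrix_inv M ** M = mat 1"
    using someI_ex[of "\<lambda>A'. M ** A' = mat 1 \<and> A' ** M = mat 1"]
    by (auto simp: matrix_inv_def invertible_def)
  then show "M *v (matrix_inv M *v x) = x" "matrix_inv M *v (M *v x) = x"
    by (simp_all add: matrix_vector_mul_assoc)
  show "transpose M *v (transpose (matrix_inv M) *v x) = x"
    "transpose (matrix_inv M) *v (transpose M *v x) = x"
    using * by (simp_all only: matrix_vector_mul_assoc matrix_transpose_mul[symmetric]
        transpose_mat matrix_vector_mul_lid)
qed

text \<open>Along the backward orbit, Cayley-Hamilton is a two-term recurrence in each coordinate,
  with the eigenvalues of \<open>M\<close> as \<open>a\<close> and \<open>b\<close>.\<close>

lemma summable_expanding:
  fixes M :: "real^2^2"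
  assumes M: "expanding M"
  shows "summable (\<lambda>k. norm ((((*v) (matrix_inv M)) ^^ k) x))"
proof -
  define u where "u k = (((*v) (matrix_inv M)) ^^ k) x" for k
  have Mu: "M *v u (Suc k) = u k" for k
    by (simp add: u_def matrix_mult_inv_cancel expanding_det_nonzero[OF M])
  \<comment> \<open>Cayley-Hamilton in dimension two, applied to a vector.\<close>
  have CH: "M *v (M *v y) = (M$1$1 + M$2$2) *\<^sub>R (M *v y) - det M *\<^sub>R y" for y
    by (simp add: vec_eq_iff forall_2 matrix_vector_mult_def sum_2 det_2 algebra_simps)
  obtain a b where ab: "a + b = complex_of_real (M$1$1 + M$2$2)" "a * b = of_real (det M)"
    "a\<^sup>2 - of_real (M$1$1 + M$2$2) * a + of_real (det M) = 0"
    "b\<^sup>2 - of_real (M$1$1 + M$2$2) * b + of_real (det M) = 0"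
    by (rule charpoly_roots)
  have "norm a > 1" "norm b > 1"
    using M eigenvalue_of_charpoly_root ab(3,4) by (auto simp: expanding_def)
  moreover have "complex_of_real (u k $ i)
      = (a + b) * of_real (u (Suc k) $ i) - a * b * of_real (u (Suc (Suc k)) $ i)" for i k
    unfolding ab using CH[of "u (Suc (Suc k))"]
    by (simp add: Mu vec_eq_iff flip: of_real_mult of_real_diff of_real_add)
  ultimately have "summable (\<lambda>k. norm (complex_of_real (u k $ i)))" for i
    by (rule summable_of_recurrence)
  then have "summable (\<lambda>k. \<Sum>i\<in>UNIV. \<bar>u k $ i\<bar>)"
    by (intro summable_sum) simp
  then show ?thesis
    unfolding u_def[symmetric]
    by (rule summable_comparison_test'[where N=0]) (simp add: norm_le_l1_cart)
qed

text \<open>The inner product of two exponentials is the transform at the difference of frequencies.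
  Solving the zero condition for that difference turns inverse powers into powers of the transpose;
  they start at \<open>Suc k\<close> because the first mask factor is already evaluated at one
  inverse step.\<close>

lemma orthogonal_exponentials_iff:
  fixes M :: "real^2^2"
  assumes M: "expanding M" and D: "finite D" "D \<noteq> {}"
  shows "orthogonal_exponentials (self_affine_measure M D) \<Lambda> \<longleftrightarrow>
    (\<forall>l\<in>\<Lambda>. \<forall>l'\<in>\<Lambda>. l \<noteq> l' \<longrightarrow>
      (\<exists>k. \<exists>z\<in>zero_set (mask_poly D). l - l' = (((*v) (transpose M)) ^^ Suc k) z))"
proof -
  note sum = summable_expanding[OF M]
  have lim: "(\<lambda>k. (((*v) (matrix_inv M)) ^^ k) x) \<longlonglongrightarrow> 0" for x
    using summable_LIMSEQ_zero[OF sum] by (rule tendsto_norm_zero_cancel)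
  have inv: "(((*v) (transpose (matrix_inv M))) ^^ k) y = z \<longleftrightarrow> y = (((*v) (transpose M)) ^^ k) z" for k y z
  proof (induction k arbitrary: z)
    case (Suc k)
    have "(((*v) (transpose (matrix_inv M))) ^^ Suc k) y = z \<longleftrightarrow>
      (((*v) (transpose (matrix_inv M))) ^^ k) y = transpose M *v z"
      using matrix_mult_inv_cancel(3,4)[OF expanding_det_nonzero[OF M]] by auto
    then show ?case unfolding Suc by (simp add: funpow_swap1 del: transpose_matrix_vector)
  qed simp
  show ?thesis
    unfolding orthogonal_exponentials_def L2_inner_expo
      fourier_eq_0_iff[OF self_affine_measure_is_self_affine[OF D sum] D lim]
    by (auto simp: zero_set_def simp del: funpow.simps) (metis inv)+
qed

section \<open>Fractional lattice points and the upper bound\<close>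

text \<open>Stated without representatives in the unit square, which makes the action of integer
  matrices easy to follow.\<close>

definition frac_points :: "nat \<Rightarrow> (real^2) set" where
  "frac_points q = {x. real q *\<^sub>R x \<in> int_lattice \<and> x \<notin> int_lattice}"

lemma E2_ring_plus_lattice_subset:
  assumes "q > 0"
  shows "E2_ring q + int_lattice \<subseteq> frac_points q"
proof
  fix x assume "x \<in> E2_ring q + int_lattice"
  then obtain a z where x': "x = a + z" "a \<in> E2 q" "a \<noteq> 0" and z: "z \<in> int_lattice"
    by (auto simp: E2_ring_def set_plus_def)
  then obtain l1 l2 :: int where a: "a = (1 / real q) *\<^sub>R vector [of_int l1, of_int l2]"
    and l: "0 \<le> l1" "l1 < q" "0 \<le> l2" "l2 < q"
    by (auto simp: E2_def)
  note x = x'(1)[unfolded a]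
  have "real q *\<^sub>R x \<in> int_lattice"
    using assms z by (auto simp: x int_lattice_def forall_2 algebra_simps)
  moreover have "x \<notin> int_lattice"
  proof
    assume "x \<in> int_lattice"
    then have "of_int l1 / real q \<in> \<int>" "of_int l2 / real q \<in> \<int>"
      using z by (auto simp: x int_lattice_def forall_2 dest: Ints_diff)
    have zero: "m = 0" if m: "of_int m / real q \<in> \<int>" "0 \<le> m" "m < q" for m :: int
    proof -
      have "of_int m / real q = 0"
        using m assms by (intro Ints_nonzero_abs_less1) auto
      then show ?thesis using assms by simp
    qed
    have "l1 = 0" "l2 = 0" using zero l \<open>of_int l1 / real q \<in> \<int>\<close> \<open>of_int l2 / real q \<in> \<int>\<close> by auto
    then show False using x'(3) by (simp add: a vec_eq_iff forall_2)
  qed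
  ultimately show "x \<in> frac_points q" by (simp add: frac_points_def)
qed

lemma int_lattice_matrix_mult:
  assumes "x \<in> int_lattice"
  shows "map_matrix real_of_int A *v x \<in> int_lattice"
  using assms by (auto simp: int_lattice_def matrix_vector_mult_def)

text \<open>Only non-integrality needs care. If \<open>A\<close> maps \<open>x\<close> to an integer
  vector, the adjugate shows that det A times \<open>x\<close> is integral; \<open>q\<close> times
  \<open>x\<close> is integral too, and Bezout combines the two to make \<open>x\<close>
  integral.\<close>

lemma frac_points_matrix_mult:
  fixes A :: "int^2^2"
  assumes x: "x \<in> frac_points q" and "coprime (det A) (int q)"
  shows "map_matrix real_of_int A *v x \<in> frac_points q"
proof -
  let ?A = "map_matrix real_of_int A"
  have "real q *\<^sub>R (?A *v x) = ?A *v (real q *\<^sub>R x)"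
    by (simp add: matrix_vector_mult_scaleR)
  then have "real q *\<^sub>R (?A *v x) \<in> int_lattice"
    using x int_lattice_matrix_mult[of "real q *\<^sub>R x" A] by (simp add: frac_points_def)
  moreover have "x \<in> int_lattice" if y: "?A *v x \<in> int_lattice"
  proof -
    obtain u v where uv: "u * det A + v * int q = 1"
      using bezout_int[of "det A" "int q"] assms(2) by auto
    have d: "of_int (det A) * x $ 1 = of_int (A$2$2) * (?A *v x) $ 1 - of_int (A$1$2) * (?A *v x) $ 2"
      "of_int (det A) * x $ 2 = of_int (A$1$1) * (?A *v x) $ 2 - of_int (A$2$1) * (?A *v x) $ 1"
      by (simp_all add: det_2 matrix_vector_mult_def sum_2 algebra_simps)
    have dx: "of_int (det A) * x $ i \<in> \<int>" for i
      using d y exhaust_2[of i] by (auto simp: int_lattice_def)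
    have qx: "real q * x $ i \<in> \<int>" for i
      using x by (simp add: frac_points_def int_lattice_def)
    have "x $ i \<in> \<int>" for i
    proof -
      have "of_int u * (of_int (det A) * x $ i) + of_int v * (real q * x $ i) \<in> \<int>"
        by (rule Ints_add[OF Ints_mult[OF Ints_of_int dx] Ints_mult[OF Ints_of_int qx]])
      moreover have "of_int u * (of_int (det A) * x $ i) + of_int v * (real q * x $ i)
          = of_int (u * det A + v * int q) * x $ i"
        by (simp add: algebra_simps)
      ultimately show ?thesis unfolding uv by simp
    qed
    then show ?thesis by (simp add: int_lattice_def)
  qed
  ultimately show ?thesis using x by (auto simp: frac_points_def)
qed

text \<open>After translation by one element and scaling by \<open>q\<close>, the set consists of
  integer vectors that are pairwise distinct modulo \<open>q\<close>, and there are
  \<open>q\<close>-squared residue pairs.\<close>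

lemma card_le_of_frac_differences:
  assumes q: "q > 0" and diff: "\<And>l l'. l \<in> \<Lambda> \<Longrightarrow> l' \<in> \<Lambda> \<Longrightarrow> l \<noteq> l' \<Longrightarrow> l - l' \<in> frac_points q"
  shows "finite \<Lambda> \<and> card \<Lambda> \<le> q\<^sup>2"
proof (cases "\<Lambda> = {}")
  case False
  then obtain l0 where l0: "l0 \<in> \<Lambda>" by auto
  \<comment> \<open>The floor only changes the type to \<open>int\<close>; by the next fact nothing
    is rounded on \<Lambda>.\<close>
  define h where "h i l = \<lfloor>real q * (l - l0) $ i\<rfloor>" for i :: 2 and l :: "real^2"
  have h: "of_int (h i l) = real q * (l - l0) $ i" if "l \<in> \<Lambda>" for i l
  proof (cases "l = l0")
    case False
    then have "real q *\<^sub>R (l - l0) \<in> int_lattice" using diff[OF that l0] by (simp add: frac_points_def)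
    then show ?thesis by (simp add: h_def int_lattice_def)
  qed (simp add: h_def)
  define f where "f l = (h 1 l mod int q, h 2 l mod int q)" for l
  have "inj_on f \<Lambda>"
  proof (rule inj_onI, rule ccontr)
    fix l l' assume l: "l \<in> \<Lambda>" "l' \<in> \<Lambda>" and e: "f l = f l'" and "l \<noteq> l'"
    have "(l - l') $ i \<in> \<int>" for i
    proof -
      have "h i l mod int q = h i l' mod int q" using e exhaust_2[of i] by (auto simp: f_def)
      then obtain c where c: "h i l - h i l' = int q * c"
        by (metis dvdE mod_eq_dvd_iff)
      have "real q * (l - l') $ i = of_int (h i l - h i l')"
        using h[OF l(1), of i] h[OF l(2), of i] by (simp add: algebra_simps)
      then have "(l - l') $ i = of_int c" using q by (simp add: c)
      then show ?thesis by simp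
    qed
    then show False using diff[OF l \<open>l \<noteq> l'\<close>] by (simp add: frac_points_def int_lattice_def)
  qed
  moreover have "f ` \<Lambda> \<subseteq> {0..<int q} \<times> {0..<int q}" using q by (auto simp: f_def)
  moreover have "finite ({0..<int q} \<times> {0..<int q})" by simp
  moreover have "card ({0..<int q} \<times> {0..<int q}) = q\<^sup>2" by (simp add: card_cartesian_product power2_eq_square)
  ultimately show ?thesis
    using card_inj_on_le[of f \<Lambda> "{0..<int q} \<times> {0..<int q}"] inj_on_finite by fastforce
qed simp

theorem at_most_orthogonal_exponentials_of_zero_set:
  fixes M :: "int^2^2" and p \<eta> :: nat
  assumes "p > 0" and D: "finite D" "D \<noteq> {}"
    and Z: "zero_set (mask_poly D) \<subseteq> E2_ring (p ^ \<eta>) + int_lattice"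
    and M: "expanding (map_matrix real_of_int M)" and cop: "coprime (det M) (int p)"
  shows "at_most_orthogonal_exponentials
    (self_affine_measure (map_matrix real_of_int M) D) (p ^ (2 * \<eta>))"
  unfolding at_most_orthogonal_exponentials_def
proof (intro allI impI)
  fix \<Lambda> assume \<Lambda>: "orthogonal_exponentials (self_affine_measure (map_matrix real_of_int M) D) \<Lambda>"
  have t: "transpose (map_matrix real_of_int M) = map_matrix real_of_int (transpose M)"
    by (simp add: vec_eq_iff transpose_def)
  have pw: "(((*v) (map_matrix real_of_int (transpose M))) ^^ k) z \<in> frac_points (p ^ \<eta>)"
    if "z \<in> frac_points (p ^ \<eta>)" for k z
  proof (induction k)
    case (Suc k)
    have "coprime (det (transpose M)) (int (p ^ \<eta>))"
      using cop by (simp add: det_transpose)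
    then show ?case using frac_points_matrix_mult[OF Suc] by simp
  qed (simp add: that)
  have "l - l' \<in> frac_points (p ^ \<eta>)" if ll: "l \<in> \<Lambda>" "l' \<in> \<Lambda>" "l \<noteq> l'" for l l'
  proof -
    obtain k z where z: "z \<in> zero_set (mask_poly D)"
      and l: "l - l' = (((*v) (transpose (map_matrix real_of_int M))) ^^ Suc k) z"
      using \<Lambda>[unfolded orthogonal_exponentials_iff[OF M D], rule_format, OF ll] by auto
    have "z \<in> frac_points (p ^ \<eta>)"
      using subsetD[OF E2_ring_plus_lattice_subset subsetD[OF Z z]] \<open>p > 0\<close> by simp
    then show ?thesis unfolding l t by (rule pw)
  qed
  from card_le_of_frac_differences[where q="p ^ \<eta>", OF _ this] \<open>p > 0\<close>
  show "finite \<Lambda> \<and> card \<Lambda> \<le> p ^ (2 * \<eta>)"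
    by (simp add: power_even_eq)
qed

section \<open>Integer orbits and large orthogonal families\<close>

definition real_vec :: "int^'n \<Rightarrow> real^'n" where
  "real_vec v = (\<chi> i. of_int (v $ i))"

lemma real_vec_nth [simp]: "real_vec v $ i = of_int (v $ i)"
  by (simp add: real_vec_def)

lemma real_vec_diff: "real_vec (u - v) = real_vec u - real_vec v"
  by (simp add: vec_eq_iff)

lemma real_vec_funpow_matrix:
  fixes A :: "int^'n^'n"
  shows "real_vec ((((*v) A) ^^ k) v) = (((*v) (map_matrix real_of_int A)) ^^ k) (real_vec v)"
  by (induction k) (simp_all add: vec_eq_iff matrix_vector_mult_def)

lemma funpow_matrix_diff:
  fixes A :: "real^'n^'n"
  shows "(((*v) A) ^^ k) (x - y) = (((*v) A) ^^ k) x - (((*v) A) ^^ k) y"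
  by (induction k) (simp_all add: matrix_vector_mult_diff_distrib)

lemma funpow_matrix_scaleR:
  fixes A :: "real^'n^'n"
  shows "(((*v) A) ^^ k) (c *\<^sub>R x) = c *\<^sub>R (((*v) A) ^^ k) x"
  by (induction k) (simp_all add: matrix_vector_mult_scaleR)

text \<open>Only the first coordinate is prescribed in \<open>A_set\<close>; the second one is
  reduced modulo p^s and its quotient goes into the lattice part.\<close>

lemma A_set_plus_lattice_memI:
  fixes v :: "int^2"
  assumes "p > 0" and v: "int (p ^ s) dvd v $ 1 - int (p ^ (s - 1))"
  shows "(1 / real (p ^ s)) *\<^sub>R real_vec v \<in> A_set p s + int_lattice"
proof -
  define q where "q = p ^ s"
  have q: "q > 0" using assms by (simp add: q_def)
  obtain c where c: "v $ 1 = int (p ^ (s - 1)) + int q * c"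
    using v by (auto simp: q_def dvd_def algebra_simps)
  define l where "l = v $ 2 mod int q"
  define d where "d = v $ 2 div int q"
  have d: "v $ 2 = l + int q * d" by (simp add: l_def d_def)
  let ?a = "(1 / real q) *\<^sub>R (vector [real (p ^ (s - 1)), of_int l] :: real^2)"
  let ?z = "vector [of_int c, of_int d] :: real^2"
  have "?a \<in> A_set p s"
    using q by (auto simp: A_set_def l_def simp flip: q_def)
  moreover have "?z \<in> int_lattice" by (simp add: int_lattice_def forall_2)
  moreover have "(1 / real q) *\<^sub>R real_vec v = ?a + ?z"
    using q by (simp add: vec_eq_iff forall_2 c d add_divide_distrib)
  ultimately show ?thesis unfolding q_def[symmetric] by (metis set_plus_intro)
qed

text \<open>For \<open>u\<close> and \<open>v\<close> in the box of residues, \<open>hit\<close>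
  supplies a power \<open>j\<close> bringing \<open>u - v\<close> to a vector which, after division
  by \<open>q\<close> and multiplication by \<open>N\<close>, is a zero of the mask. The remaining K
  - j powers realise the difference of frequencies as an image of that zero.\<close>

lemma contains_orthogonal_exponentials_of_orbits:
  fixes M :: "int^2^2" and N :: int
  assumes D: "finite D" "D \<noteq> {}" and M: "expanding (map_matrix real_of_int M)"
    and p: "p > 0" and N: "N \<noteq> 0"
    and Z: "(\<lambda>x. real_of_int N *\<^sub>R x) ` (A_set p \<eta> + int_lattice) \<subseteq> zero_set (mask_poly D)"
    and hit: "\<And>v. \<not> (\<forall>i. int (p ^ \<eta>) dvd v $ i) \<Longrightarrow>
      \<exists>j. int (p ^ \<eta>) dvd ((((*v) (transpose M)) ^^ j) v) $ 1 - int (p ^ (\<eta> - 1))"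
  shows "contains_orthogonal_exponentials
    (self_affine_measure (map_matrix real_of_int M) D) (p ^ (2 * \<eta>))"
proof -
  define q where "q = p ^ \<eta>"
  have q: "q > 0" using p by (simp add: q_def)
  define A where "A = transpose (map_matrix real_of_int M)"
  have A: "A = map_matrix real_of_int (transpose M)"
    by (simp add: A_def vec_eq_iff transpose_def)
  define V where "V = (\<lambda>(a, b). vector [a, b] :: int^2) ` ({0..<int q} \<times> {0..<int q})"
  have "inj_on (\<lambda>(a, b). vector [a, b] :: int^2) ({0..<int q} \<times> {0..<int q})"
    by (auto simp: inj_on_def vec_eq_iff forall_2)
  then have cardV: "card V = q\<^sup>2" unfolding V_def
    by (simp add: card_image card_cartesian_product power2_eq_square)
  have finV: "finite V" by (simp add: V_def)
  have Vdiff: "\<not> (\<forall>i. int q dvd (u - v) $ i)" if "u \<in> V" "v \<in> V" "u \<noteq> v" for u v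
  proof
    assume "\<forall>i. int q dvd (u - v) $ i"
    then have "u $ i mod int q = v $ i mod int q" for i by (simp add: mod_eq_dvd_iff)
    moreover have "u $ i mod int q = u $ i" "v $ i mod int q = v $ i" for i
      using that(1,2) exhaust_2[of i] by (auto simp: V_def)
    ultimately show False using that(3) by (simp add: vec_eq_iff)
  qed
  define J where "J v = (SOME j. int q dvd ((((*v) (transpose M)) ^^ j) v) $ 1 - int (p ^ (\<eta> - 1)))" for v
  have J: "int q dvd ((((*v) (transpose M)) ^^ J v) v) $ 1 - int (p ^ (\<eta> - 1))"
    if "\<not> (\<forall>i. int q dvd v $ i)" for v
    unfolding J_def using that by (rule someI_ex[OF hit[folded q_def]])
  \<comment> \<open>The successor leaves at least one power after any \<open>J (u - v)\<close>, as
    the orthogonality criterion demands.\<close>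
  define K where "K = Suc (Max ((\<lambda>(u, v). J (u - v)) ` (V \<times> V)))"
  have K: "J (u - v) < K" if "u \<in> V" "v \<in> V" for u v
    unfolding K_def less_Suc_eq_le using finV that by (intro Max_ge) auto
  define f where "f v = (real_of_int N / real q) *\<^sub>R (((*v) A) ^^ K) (real_vec v)" for v
  have diff: "\<exists>k. \<exists>z\<in>zero_set (mask_poly D). f u - f v = (((*v) A) ^^ Suc k) z"
    if "u \<in> V" "v \<in> V" "u \<noteq> v" for u v
  proof -
    define j where "j = J (u - v)"
    define k where "k = K - Suc j"
    have Kjk: "K = Suc k + j" using K[OF that(1,2)] by (simp add: k_def j_def)
    define y where "y = (((*v) (transpose M)) ^^ j) (u - v)"
    define z where "z = real_of_int N *\<^sub>R ((1 / real q) *\<^sub>R real_vec y)"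
    have "z \<in> zero_set (mask_poly D)"
      using Z A_set_plus_lattice_memI[OF p, of \<eta> y] J[OF Vdiff[OF that]]
      unfolding z_def y_def j_def q_def by blast
    moreover have "f u - f v = (((*v) A) ^^ Suc k) z"
    proof -
      have "f u - f v = (real_of_int N / real q) *\<^sub>R (((*v) A) ^^ K) (real_vec (u - v))"
        by (simp add: f_def funpow_matrix_diff real_vec_diff scaleR_diff_right)
      also have "(((*v) A) ^^ K) (real_vec (u - v)) = (((*v) A) ^^ Suc k) (real_vec y)"
        unfolding Kjk funpow_add o_apply y_def real_vec_funpow_matrix A ..
      also have "(real_of_int N / real q) *\<^sub>R \<dots> = (((*v) A) ^^ Suc k) z"
        unfolding z_def funpow_matrix_scaleR by simp
      finally show ?thesis .
    qed
    ultimately show ?thesis by blast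
  qed
  \<comment> \<open>Injectivity keeps the frequencies distinct, so that their number is still that
    of the residue vectors.\<close>
  have invA: "inj (((*v) A) ^^ k)" for k
  proof -
    have "inj ((*v) A)"
      unfolding A_def
      using matrix_mult_inv_cancel(4)[OF expanding_det_nonzero[OF M]] by (rule inj_on_inverseI)
    then show ?thesis by (induction k) (auto intro: inj_compose)
  qed
  have "inj f"
  proof (rule injI)
    fix u v assume "f u = f v"
    then have "(((*v) A) ^^ K) (real_vec u) = (((*v) A) ^^ K) (real_vec v)"
      using N q by (simp add: f_def)
    then have "real_vec u = real_vec v" using invA by (metis injD)
    then show "u = v" by (simp add: vec_eq_iff)
  qed
  then have "card (f ` V) = p ^ (2 * \<eta>)"
    using cardV by (simp add: card_image inj_on_subset q_def power_even_eq)
  moreover have "orthogonal_exponentials (self_affine_measure (map_matrix real_of_int M) D) (f ` V)"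
    unfolding orthogonal_exponentials_iff[OF M D] A_def[symmetric]
    using diff by (auto simp del: funpow.simps)
  ultimately show ?thesis
    unfolding contains_orthogonal_exponentials_def using finV by blast
qed

section \<open>Orbits in an imaginary quadratic order at an inert prime\<close>

text \<open>The binomial theorem truncated after the quadratic term. The set \<open>S\<close>
  records that the cofactor of the cubic remainder stays in the subring generated by
  \<open>x\<close>; below, \<open>S\<close> is the quadratic order and \<open>x\<close> is divisible
  by p.\<close>

lemma one_plus_power_expansion:
  fixes x :: "'a::comm_ring_1"
  assumes "1 \<in> S" "x \<in> S" and add: "\<And>a b. a \<in> S \<Longrightarrow> b \<in> S \<Longrightarrow> a + b \<in> S"
    and mult: "\<And>a b. a \<in> S \<Longrightarrow> b \<in> S \<Longrightarrow> a * b \<in> S" and zero: "0 \<in> S"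
  shows "\<exists>y\<in>S. (1 + x) ^ k = 1 + of_nat k * x + of_nat (k choose 2) * x\<^sup>2 + x ^ 3 * y"
proof (induction k)
  case 0
  show ?case by (rule bexI[OF _ zero]) (simp add: numeral_2_eq_2)
next
  case (Suc k)
  then obtain y where y: "y \<in> S" and e: "(1 + x) ^ k = 1 + of_nat k * x + of_nat (k choose 2) * x\<^sup>2 + x ^ 3 * y" ..
  have of_nat: "of_nat n \<in> S" for n using assms by (induction n) auto
  have "(1 + x) ^ Suc k = 1 + of_nat (Suc k) * x + of_nat (Suc k choose 2) * x\<^sup>2
      + x ^ 3 * (of_nat (k choose 2) + y + x * y)"
    unfolding power_Suc e by (simp add: numeral_2_eq_2 numeral_3_eq_3 algebra_simps)
  moreover have "of_nat (k choose 2) + y + x * y \<in> S"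
    using y assms(2) of_nat by (intro add mult)
  ultimately show ?case by blast
qed

text \<open>The order Z[sqrt(-m)] is realised inside the complex numbers: ring identities are
  inherited, and only membership in \<open>R\<close> has to be tracked.\<close>

locale quad_order =
  fixes m :: int
  assumes m_pos: "m > 0"
begin

definition w :: complex where
  "w = \<i> * complex_of_real (sqrt (of_int m))"

definition elt :: "int \<Rightarrow> int \<Rightarrow> complex" where
  "elt a b = of_int a + of_int b * w"

definition R :: "complex set" where
  "R = range (\<lambda>(a, b). elt a b)"

text \<open>A coordinate function on \<open>R\<close>, where the real part is already an integer;
  likewise for \<open>irr_part\<close>. Outside \<open>R\<close> the values carry no
  meaning.\<close>

definition rat_part :: "complex \<Rightarrow> int" where
  "rat_part z = \<lfloor>Re z\<rfloor>"

definition irr_part :: "complex \<Rightarrow> int" where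
  "irr_part z = \<lfloor>Im z / sqrt (of_int m)\<rfloor>"

lemma w_sq: "w * w = - of_int m"
proof -
  let ?s = "complex_of_real (sqrt (of_int m))"
  have "?s * ?s = of_int m"
    using m_pos by (simp flip: of_real_mult)
  then show ?thesis by (simp add: w_def algebra_simps)
qed

lemma rat_part_elt [simp]: "rat_part (elt a b) = a"
  by (simp add: rat_part_def elt_def w_def)

lemma irr_part_elt [simp]: "irr_part (elt a b) = b"
  using m_pos by (simp add: irr_part_def elt_def w_def)

lemma elt_eq_iff [simp]: "elt a b = elt c d \<longleftrightarrow> a = c \<and> b = d"
  by (metis rat_part_elt irr_part_elt)

lemma elt_in_R [simp]: "elt a b \<in> R"
  by (auto simp: R_def)

lemma R_eq: "z \<in> R \<Longrightarrow> elt (rat_part z) (irr_part z) = z"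
  by (auto simp: R_def)

lemma R_cases:
  assumes "z \<in> R"
  obtains a b where "z = elt a b"
  using assms by (auto simp: R_def)

lemma elt_add: "elt a b + elt c d = elt (a + c) (b + d)"
  by (simp add: elt_def algebra_simps)

lemma elt_diff: "elt a b - elt c d = elt (a - c) (b - d)"
  by (simp add: elt_def algebra_simps)

lemma elt_mult: "elt a b * elt c d = elt (a * c - m * b * d) (a * d + b * c)"
proof -
  have "elt a b * elt c d = of_int (a * c) + of_int (b * d) * (w * w) + of_int (a * d + b * c) * w"
    by (simp add: elt_def algebra_simps)
  also have "\<dots> = elt (a * c - m * b * d) (a * d + b * c)"
    unfolding w_sq by (simp add: elt_def algebra_simps)
  finally show ?thesis .
qed

lemma elt_of_int: "of_int a = elt a 0"
  by (simp add: elt_def)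

lemma w_eq: "w = elt 0 1"
  by (simp add: elt_def)

lemma one_eq: "1 = elt 1 0"
  by (simp add: elt_def)

lemma zero_eq: "0 = elt 0 0"
  by (simp add: elt_def)

lemma R_of_int [simp]: "of_int a \<in> R"
  by (simp add: elt_of_int)

lemma R_closed [simp]:
  "1 \<in> R" "0 \<in> R" "w \<in> R"
  "x \<in> R \<Longrightarrow> y \<in> R \<Longrightarrow> x + y \<in> R"
  "x \<in> R \<Longrightarrow> y \<in> R \<Longrightarrow> x - y \<in> R"
  "x \<in> R \<Longrightarrow> y \<in> R \<Longrightarrow> x * y \<in> R"
  by (auto simp: one_eq zero_eq w_eq elt_add elt_diff elt_mult elim!: R_cases)

lemma R_power [simp]: "x \<in> R \<Longrightarrow> x ^ k \<in> R"
  by (induction k) auto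

lemma R_of_nat [simp]: "of_nat k \<in> R"
  using R_of_int[of "int k"] by simp

lemma R_uminus [simp]: "x \<in> R \<Longrightarrow> - x \<in> R"
  using R_closed(5)[of 0 x] by simp

lemma rat_part_add: "x \<in> R \<Longrightarrow> y \<in> R \<Longrightarrow> rat_part (x + y) = rat_part x + rat_part y"
  by (auto simp: elt_add elim!: R_cases)

lemma irr_part_add: "x \<in> R \<Longrightarrow> y \<in> R \<Longrightarrow> irr_part (x + y) = irr_part x + irr_part y"
  by (auto simp: elt_add elim!: R_cases)

lemma irr_part_of_int_mult: "x \<in> R \<Longrightarrow> irr_part (of_int k * x) = k * irr_part x"
  by (auto simp: elt_of_int elt_mult elim!: R_cases)

lemma rat_part_mult: "x \<in> R \<Longrightarrow> y \<in> R \<Longrightarrow> rat_part (x * y) = rat_part x * rat_part y - m * irr_part x * irr_part y"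
  by (auto simp: elt_mult elim!: R_cases)

lemma rat_part_of_int_mult: "x \<in> R \<Longrightarrow> rat_part (of_int k * x) = k * rat_part x"
  by (auto simp: elt_of_int elt_mult elim!: R_cases)

text \<open>Congruence modulo the ideal kR. The explicit cofactor in \<open>R\<close> allows proofs
  by ring identities; \<open>cong_mod_elt\<close> gives the coordinate form.\<close>

definition cong_mod :: "int \<Rightarrow> complex \<Rightarrow> complex \<Rightarrow> bool" where
  "cong_mod k x y \<longleftrightarrow> (\<exists>z\<in>R. x = y + of_int k * z)"

lemma cong_mod_elt: "cong_mod k (elt a b) (elt c d) \<longleftrightarrow> k dvd a - c \<and> k dvd b - d"
proof
  assume "cong_mod k (elt a b) (elt c d)"
  then obtain e f where "elt a b = elt c d + of_int k * elt e f"
    by (auto simp: cong_mod_def elim!: R_cases)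
  then show "k dvd a - c \<and> k dvd b - d" by (simp add: elt_of_int elt_mult elt_add)
next
  assume "k dvd a - c \<and> k dvd b - d"
  then obtain e f where "a - c = k * e" "b - d = k * f" by (auto elim!: dvdE)
  then have "a = c + k * e" "b = d + k * f" by simp_all
  then have "elt a b = elt c d + of_int k * elt e f" by (simp add: elt_of_int elt_mult elt_add)
  then show "cong_mod k (elt a b) (elt c d)" unfolding cong_mod_def by (metis elt_in_R)
qed

lemma cong_mod_iff: "x \<in> R \<Longrightarrow> y \<in> R \<Longrightarrow> cong_mod k x y \<longleftrightarrow> k dvd rat_part x - rat_part y \<and> k dvd irr_part x - irr_part y"
  using cong_mod_elt[of k "rat_part x" "irr_part x" "rat_part y" "irr_part y"] by (simp add: R_eq)

lemma cong_mod_refl [simp]: "cong_mod k x x"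
  unfolding cong_mod_def by (rule bexI[of _ 0]) auto

lemma cong_mod_trans [trans]: "cong_mod k x y \<Longrightarrow> cong_mod k y z \<Longrightarrow> cong_mod k x z"
  unfolding cong_mod_def
proof (elim bexE)
  fix a b assume "a \<in> R" "b \<in> R" "x = y + of_int k * a" "y = z + of_int k * b"
  then show "\<exists>c\<in>R. x = z + of_int k * c"
    by (intro bexI[of _ "a + b"]) (auto simp: algebra_simps)
qed

lemma cong_mod_sym: "cong_mod k x y \<Longrightarrow> cong_mod k y x"
  unfolding cong_mod_def
proof (elim bexE)
  fix a assume "a \<in> R" "x = y + of_int k * a"
  then show "\<exists>c\<in>R. y = x + of_int k * c" by (intro bexI[of _ "- a"]) auto
qed

lemma cong_mod_mult:
  assumes "x \<in> R" "y' \<in> R" "cong_mod k x y" "cong_mod k x' y'"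
  shows "cong_mod k (x * x') (y * y')"
proof -
  obtain a b where ab: "a \<in> R" "b \<in> R" "x = y + of_int k * a" "x' = y' + of_int k * b"
    using assms(3,4) by (auto simp: cong_mod_def)
  have "x * x' = y * y' + of_int k * (a * y' + x * b)"
    by (simp add: ab(3,4) algebra_simps)
  moreover have "a * y' + x * b \<in> R" using assms(1,2) ab(1,2) by simp
  ultimately show ?thesis unfolding cong_mod_def by (rule bexI)
qed

lemma cong_mod_add:
  assumes "cong_mod k x y" "cong_mod k x' y'"
  shows "cong_mod k (x + x') (y + y')"
proof -
  obtain a b where ab: "a \<in> R" "b \<in> R" "x = y + of_int k * a" "x' = y' + of_int k * b"
    using assms by (auto simp: cong_mod_def)
  have "x + x' = y + y' + of_int k * (a + b)"
    by (simp add: ab(3,4) algebra_simps)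
  moreover have "a + b \<in> R" using ab(1,2) by simp
  ultimately show ?thesis unfolding cong_mod_def by (rule bexI)
qed

lemma cong_mod_power:
  assumes "x \<in> R" "y \<in> R" "cong_mod k x y"
  shows "cong_mod k (x ^ n) (y ^ n)"
  using assms by (induction n) (auto intro!: cong_mod_mult)

lemma cong_mod_rat_part: "x \<in> R \<Longrightarrow> y \<in> R \<Longrightarrow> cong_mod k x y \<Longrightarrow> k dvd rat_part x - rat_part y"
  by (simp add: cong_mod_iff)

end

section \<open>The residue field at an inert prime\<close>

locale inert_prime = quad_order +
  fixes p :: nat
  assumes prime: "prime p" and inert: "\<And>x :: int. \<not> int p dvd x\<^sup>2 + m"
begin

lemma prime_int: "prime (int p)" using prime by simp

lemma p_gt_1: "int p > 1" using prime prime_gt_1_nat by auto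

lemma inverse_mod:
  assumes "\<not> int p dvd a"
  obtains e where "int p dvd a * e - 1"
proof -
  have "coprime a (int p)" using assms prime_int by (metis coprime_commute prime_imp_coprime)
  then obtain u v where "u * a + v * int p = 1" using bezout_int[of a "int p"] by auto
  then have "a * u - 1 = int p * (- v)" by (simp add: algebra_simps)
  then show ?thesis using that by (metis dvd_triv_left)
qed

text \<open>This is the norm of a + bw. If p divided it with b a unit modulo p, then a/b would be a
  square root of -m modulo p. The lemma provides inverses in \<open>F\<close> and later the
  coprimality of the determinant.\<close>

lemma norm_not_dvd:
  assumes "\<not> (int p dvd a \<and> int p dvd b)"
  shows "\<not> int p dvd a\<^sup>2 + m * b\<^sup>2"
proof
  assume d: "int p dvd a\<^sup>2 + m * b\<^sup>2"
  show False
  proof (cases "int p dvd b")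
    case True
    then have "int p dvd m * b\<^sup>2" by (simp add: power2_eq_square)
    then have "int p dvd a\<^sup>2" using d by (simp add: dvd_add_left_iff)
    then have "int p dvd a" using prime_int prime_dvd_power by blast
    then show False using True assms by simp
  next
    case False
    then obtain e where "int p dvd b * e - 1" by (rule inverse_mod)
    then obtain c where "b * e - 1 = int p * c" ..
    then have c: "b * e = 1 + int p * c" by simp
    have "(a\<^sup>2 + m * b\<^sup>2) * e\<^sup>2 = (a * e)\<^sup>2 + m * (b * e)\<^sup>2"
      by (simp add: power_mult_distrib algebra_simps)
    also have "\<dots> = ((a * e)\<^sup>2 + m) + int p * (m * c * (2 + int p * c))"
      by (simp add: c power2_eq_square algebra_simps)
    finally have "int p dvd ((a * e)\<^sup>2 + m) + int p * (m * c * (2 + int p * c))"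
      using d by (metis dvd_mult2)
    then have "int p dvd (a * e)\<^sup>2 + m" by (simp add: dvd_add_left_iff)
    then show False using inert by blast
  qed
qed

definition red :: "complex \<Rightarrow> int \<times> int" where
  "red z = (rat_part z mod int p, irr_part z mod int p)"

definition lift :: "int \<times> int \<Rightarrow> complex" where
  "lift x = elt (fst x) (snd x)"

text \<open>The quotient R/pR with reduced coordinate pairs as carrier, packaged as a ring record so
  that the theory of finite fields applies.\<close>

definition F :: "(int \<times> int) ring" where
  "F = \<lparr>carrier = red ` R, monoid.mult = (\<lambda>x y. red (lift x * lift y)), one = red 1,
    zero = red 0, add = (\<lambda>x y. red (lift x + lift y))\<rparr>"

lemma lift_in_R [simp]: "lift x \<in> R"
  by (simp add: lift_def)

lemma red_eq_iff: "x \<in> R \<Longrightarrow> y \<in> R \<Longrightarrow> red x = red y \<longleftrightarrow> cong_mod (int p) x y"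
  by (auto simp: red_def cong_mod_iff mod_eq_dvd_iff)

lemma cong_mod_lift_red: "x \<in> R \<Longrightarrow> cong_mod (int p) (lift (red x)) x"
  by (auto simp: lift_def red_def cong_mod_elt simp flip: mod_eq_dvd_iff elim!: R_cases)

lemma red_image: "red ` R = {0..<int p} \<times> {0..<int p}"
proof
  show "red ` R \<subseteq> {0..<int p} \<times> {0..<int p}" using p_gt_1 by (auto simp: red_def)
  show "{0..<int p} \<times> {0..<int p} \<subseteq> red ` R"
  proof
    fix x assume "x \<in> {0..<int p} \<times> {0..<int p}"
    then have "x = red (lift x)" by (auto simp: red_def lift_def)
    then show "x \<in> red ` R" by (rule image_eqI) simp
  qed
qed

lemma F_simps:
  "carrier F = red ` R" "\<one>\<^bsub>F\<^esub> = red 1" "\<zero>\<^bsub>F\<^esub> = red 0"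
  by (simp_all add: F_def)

lemma F_mult: "x \<in> R \<Longrightarrow> y \<in> R \<Longrightarrow> red x \<otimes>\<^bsub>F\<^esub> red y = red (x * y)"
  by (simp add: F_def red_eq_iff cong_mod_mult cong_mod_lift_red)

lemma F_add: "x \<in> R \<Longrightarrow> y \<in> R \<Longrightarrow> red x \<oplus>\<^bsub>F\<^esub> red y = red (x + y)"
  by (simp add: F_def red_eq_iff cong_mod_add cong_mod_lift_red)

text \<open>The inverse of a + bw is its conjugate times an inverse of the norm, which is a unit
  modulo p by \<open>norm_not_dvd\<close>.\<close>

lemma F_field: "field F"
proof -
  interpret F: cring F
  proof (rule cringI)
    show "abelian_group F"
    proof (rule abelian_groupI)
      fix x assume "x \<in> carrier F"
      then obtain a where "a \<in> R" "x = red a" by (auto simp: F_simps)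
      then show "\<exists>y\<in>carrier F. y \<oplus>\<^bsub>F\<^esub> x = \<zero>\<^bsub>F\<^esub>"
        by (intro bexI[of _ "red (- a)"]) (auto simp: F_simps F_add)
    qed (auto simp: F_simps F_add add_ac)
    show "comm_monoid F"
      by (rule comm_monoidI) (auto simp: F_simps F_mult mult_ac)
  qed (auto simp: F_simps F_mult F_add distrib_right)
  show ?thesis
  proof (rule F.cring_fieldI2)
    show "\<zero>\<^bsub>F\<^esub> \<noteq> \<one>\<^bsub>F\<^esub>" using p_gt_1 by (simp add: F_simps red_def zero_eq one_eq)
    fix x assume x: "x \<in> carrier F" "x \<noteq> \<zero>\<^bsub>F\<^esub>"
    then obtain a b where ab: "x = red (elt a b)" by (auto simp: F_simps elim!: R_cases)
    have "\<not> cong_mod (int p) (elt a b) 0" using x(2) by (simp add: ab F_simps red_eq_iff)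
    then have "\<not> (int p dvd a \<and> int p dvd b)" by (simp add: zero_eq cong_mod_elt)
    then obtain e where e: "int p dvd (a\<^sup>2 + m * b\<^sup>2) * e - 1"
      by (meson norm_not_dvd inverse_mod)
    have "elt a b * elt (a * e) (- (b * e)) = elt ((a\<^sup>2 + m * b\<^sup>2) * e) 0"
      by (simp add: elt_mult power2_eq_square algebra_simps)
    moreover have "cong_mod (int p) (elt ((a\<^sup>2 + m * b\<^sup>2) * e) 0) 1"
      using e by (simp add: one_eq cong_mod_elt)
    ultimately have "x \<otimes>\<^bsub>F\<^esub> red (elt (a * e) (- (b * e))) = \<one>\<^bsub>F\<^esub>"
      by (simp add: ab F_mult F_simps red_eq_iff)
    then show "\<exists>y\<in>carrier F. x \<otimes>\<^bsub>F\<^esub> y = \<one>\<^bsub>F\<^esub>" by (auto simp: F_simps)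
  qed
qed

lemma red_power: "x \<in> R \<Longrightarrow> red (x ^ k) = red x [^]\<^bsub>F\<^esub> k"
proof (induction k)
  case 0
  show ?case by (simp add: F_simps nat_pow_def)
next
  case (Suc k)
  then show ?case by (simp add: F_mult[symmetric] mult.commute[of x] nat_pow_def)
qed

lemma red_in_mult_of:
  assumes "z \<in> R" "\<not> cong_mod (int p) z 0"
  shows "red z \<in> carrier (mult_of F)"
  using assms by (simp add: F_simps red_eq_iff)

text \<open>The unit group of the finite field \<open>F\<close> is cyclic of order p^2 - 1; \<alpha>
  is any preimage of a generator.\<close>

lemma generator_exists:
  obtains \<alpha> where "\<alpha> \<in> R" "cong_mod (int p) (\<alpha> ^ (p\<^sup>2 - 1)) 1"
    "\<forall>z\<in>R. \<not> cong_mod (int p) z 0 \<longrightarrow> (\<exists>k. cong_mod (int p) (\<alpha> ^ k) z)"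
proof -
  interpret F: field F by (rule F_field)
  have fin: "finite (carrier F)" by (simp add: F_simps red_image)
  obtain g where g: "g \<in> carrier (mult_of F)"
    and gen: "carrier (mult_of F) = {g [^]\<^bsub>F\<^esub> i | i :: nat. i \<in> UNIV}"
    using F.finite_field_mult_group_has_gen[OF fin] by auto
  then obtain \<alpha> where \<alpha>: "\<alpha> \<in> R" and red: "red \<alpha> = g" by (auto simp: F_simps)
  have "order (mult_of F) = p\<^sup>2 - 1"
    using F.order_mult_of[OF fin] by (simp add: order_def F_simps red_image card_cartesian_product power2_eq_square)
  then have "g [^]\<^bsub>F\<^esub> (p\<^sup>2 - 1) = \<one>\<^bsub>F\<^esub>"
    using group.pow_order_eq_1[OF F.field_mult_group g] by (simp add: nat_pow_mult_of)
  then have "red (\<alpha> ^ (p\<^sup>2 - 1)) = red 1" by (simp add: red_power[OF \<alpha>] red F_simps)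
  then have 1: "cong_mod (int p) (\<alpha> ^ (p\<^sup>2 - 1)) 1" using \<alpha> by (simp add: red_eq_iff)
  have 2: "\<exists>k. cong_mod (int p) (\<alpha> ^ k) z" if z: "z \<in> R" "\<not> cong_mod (int p) z 0" for z
  proof -
    obtain i :: nat where "red z = g [^]\<^bsub>F\<^esub> i"
      using red_in_mult_of[OF z] unfolding gen by auto
    then have "red (\<alpha> ^ i) = red z" by (simp add: red_power[OF \<alpha>] red)
    then show ?thesis using red_eq_iff z(1) \<alpha> by auto
  qed
  show ?thesis by (rule that[OF \<alpha> 1]) (use 2 in blast)
qed
end

section \<open>Lifting the generator and orbits modulo powers of p\<close>

context inert_prime begin

text \<open>Analogue of a primitive root whose (p-1)-th power is not 1 modulo p^2. The condition is
  on the w-coefficient of \<beta> because later \<beta> multiplies vectors congruent to w, and its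
  product with w has rational part -m times that coefficient.\<close>

lemma generator_lift:
  obtains \<alpha> \<beta> where "\<alpha> \<in> R" "\<beta> \<in> R" "\<alpha> ^ (p\<^sup>2 - 1) = 1 + of_nat p * \<beta>" "\<not> int p dvd irr_part \<beta>"
    "\<forall>z\<in>R. \<not> cong_mod (int p) z 0 \<longrightarrow> (\<exists>k. cong_mod (int p) (\<alpha> ^ k) z)"
proof -
  define E where "E = p\<^sup>2 - 1"
  obtain \<alpha> where \<alpha>: "\<alpha> \<in> R" "cong_mod (int p) (\<alpha> ^ E) 1"
    and gen: "\<forall>z\<in>R. \<not> cong_mod (int p) z 0 \<longrightarrow> (\<exists>k. cong_mod (int p) (\<alpha> ^ k) z)"
    unfolding E_def by (rule generator_exists)
  obtain \<beta> where \<beta>: "\<beta> \<in> R" "\<alpha> ^ E = 1 + of_nat p * \<beta>"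
    using \<alpha>(2) by (auto simp: cong_mod_def)
  show ?thesis
  proof (cases "int p dvd irr_part \<beta>")
    case False
    then show ?thesis using that \<alpha> \<beta> gen unfolding E_def by blast
  next
    case True
    \<comment> \<open>The factor $1 + pw$ shifts the $w$-coefficient of $\beta$ by $E$, which is $-1$ modulo $p$.\<close>
    define x where "x = of_nat p * w"
    define \<alpha>' where "\<alpha>' = \<alpha> * (1 + x)"
    have x: "x \<in> R" by (simp add: x_def)
    have \<alpha>': "\<alpha>' \<in> R" using \<alpha> x by (simp add: \<alpha>'_def)
    obtain y where y: "y \<in> R"
      and e: "(1 + x) ^ E = 1 + of_nat E * x + of_nat (E choose 2) * x\<^sup>2 + x ^ 3 * y"
      using one_plus_power_expansion[of R x E] x by auto
    \<comment> \<open>Both the quadratic and the cubic term contain p^2; \<open>c\<close> collects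
      what is left of them.\<close>
    define c where "c = of_nat (E choose 2) * w\<^sup>2 + of_nat p * w ^ 3 * y"
    have c: "c \<in> R" using y by (simp add: c_def)
    have e': "(1 + x) ^ E = 1 + of_nat p * (of_nat E * w + of_nat p * c)"
      unfolding e by (simp add: x_def c_def power2_eq_square power3_eq_cube algebra_simps)
    define \<beta>' where "\<beta>' = \<beta> + of_int (int E) * w + of_int (int p) * (c + \<beta> * (of_nat E * w + of_nat p * c))"
    have \<beta>': "\<beta>' \<in> R" using \<beta> c by (simp add: \<beta>'_def)
    have "\<alpha>' ^ E = 1 + of_nat p * \<beta>'"
      unfolding \<alpha>'_def power_mult_distrib \<beta>(2) e' by (simp add: \<beta>'_def algebra_simps)
    moreover have "\<not> int p dvd irr_part \<beta>'"
    proof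
      assume d: "int p dvd irr_part \<beta>'"
      let ?X = "c + \<beta> * (of_nat E * w + of_nat p * c)"
      have X: "?X \<in> R" using \<beta> c by simp
      have "irr_part \<beta>' = irr_part (\<beta> + of_int (int E) * w) + irr_part (of_int (int p) * ?X)"
        unfolding \<beta>'_def using \<beta> c by (intro irr_part_add) auto
      also have "\<dots> = irr_part \<beta> + irr_part (of_int (int E) * w) + irr_part (of_int (int p) * ?X)"
        using \<beta> c by (subst irr_part_add) auto
      also have "\<dots> = irr_part \<beta> + int E + int p * irr_part ?X"
        using X by (simp only: irr_part_of_int_mult R_closed) (simp add: w_eq)
      finally have "irr_part \<beta>' = irr_part \<beta> + int E + int p * irr_part ?X" .
      then have "int p dvd int E"
        using d True by (metis dvd_add_left_iff dvd_add_right_iff dvd_triv_left)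
      moreover have "int E = int p * int p - 1"
        using p_gt_1 by (simp add: E_def power2_eq_square of_nat_diff)
      ultimately have "int p dvd 1" by (metis dvd_triv_left dvd_diff_right_iff dvd_diff_commute)
      then show False using p_gt_1 by simp
    qed
    moreover have "\<exists>k. cong_mod (int p) (\<alpha>' ^ k) z" if z: "z \<in> R" "\<not> cong_mod (int p) z 0" for z
    proof -
      obtain k where k: "cong_mod (int p) (\<alpha> ^ k) z" using gen z by blast
      have "cong_mod (int p) \<alpha>' \<alpha>"
        unfolding cong_mod_def using \<alpha> by (intro bexI[of _ "\<alpha> * w"]) (auto simp: \<alpha>'_def x_def algebra_simps)
      then have "cong_mod (int p) (\<alpha>' ^ k) (\<alpha> ^ k)" using \<alpha> \<alpha>' by (intro cong_mod_power)
      then show ?thesis using k cong_mod_trans by blast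
    qed
    ultimately show ?thesis using that[OF \<alpha>' \<beta>'] unfolding E_def by blast
  qed
qed

text \<open>Each p-th power raises the p-adic level of the deviation from 1 by exactly one factor p
  and keeps its leading coefficient modulo p.\<close>

lemma power_of_one_plus:
  assumes "odd p" and \<beta>: "\<beta> \<in> R"
  shows "\<exists>\<beta>'\<in>R. (1 + of_nat p * \<beta>) ^ (p ^ i) = 1 + of_nat p ^ Suc i * \<beta>' \<and> cong_mod (int p) \<beta>' \<beta>"
proof (induction i)
  case 0
  show ?case using \<beta> by (intro bexI[of _ \<beta>]) auto
next
  case (Suc i)
  then obtain b where b: "b \<in> R" "(1 + of_nat p * \<beta>) ^ (p ^ i) = 1 + of_nat p ^ Suc i * b" "cong_mod (int p) b \<beta>"
    by auto
  define x where "x = of_nat p ^ Suc i * b"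
  have x: "x \<in> R" using b by (simp add: x_def)
  obtain y where y: "y \<in> R"
    and e: "(1 + x) ^ p = 1 + of_nat p * x + of_nat (p choose 2) * x\<^sup>2 + x ^ 3 * y"
    using one_plus_power_expansion[of R x p] x by auto
  obtain h where h: "p = 2 * h + 1" using \<open>odd p\<close> by (elim oddE)
  \<comment> \<open>Oddness of p enters here: the extra factor p makes the quadratic term divisible
    by p^(2i+3), hence by p^(i+3).\<close>
  have "p choose 2 = p * h" by (simp add: choose_two) (simp add: h)
  define c where "c = of_nat h * of_nat p ^ i * b\<^sup>2 + (of_nat p ^ i)\<^sup>2 * b ^ 3 * y"
  have c: "c \<in> R" using y b by (simp add: c_def)
  have "(1 + of_nat p * \<beta>) ^ (p ^ Suc i) = ((1 + of_nat p * \<beta>) ^ (p ^ i)) ^ p"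
    by (simp add: power_mult[symmetric] mult.commute)
  also have "\<dots> = (1 + x) ^ p" by (simp only: b(2) x_def)
  also have "\<dots> = 1 + of_nat p ^ Suc (Suc i) * (b + of_int (int p) * c)"
    unfolding e \<open>p choose 2 = p * h\<close>
    by (simp add: x_def c_def power2_eq_square power3_eq_cube mult_2 power_add algebra_simps)
  finally have 1: "(1 + of_nat p * \<beta>) ^ (p ^ Suc i) = 1 + of_nat p ^ Suc (Suc i) * (b + of_int (int p) * c)" .
  have 2: "cong_mod (int p) (b + of_int (int p) * c) \<beta>"
    using cong_mod_trans[OF _ b(3)] c unfolding cong_mod_def by blast
  have 3: "b + of_int (int p) * c \<in> R" using b c by simp
  show ?case using 1 2 3 by blast
qed

lemma not_dvd_m: "\<not> int p dvd m"
  using inert[of 0] by simp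

text \<open>The p-adic digits of the rational part are corrected one by one. Multiplying
  \<open>v\<close> by the s-th power of 1 + p^(n+1) b changes its rational part by p^(n+1) s r
  modulo p^(n+2). Here \<open>r\<close> is congruent to -m times the w-coefficient of \<beta>, a
  unit, so a suitable \<open>s\<close> exists.\<close>

lemma first_coordinate_hit:
  assumes "odd p" and \<beta>: "\<beta> \<in> R" "\<not> int p dvd irr_part \<beta>" and u: "u \<in> R" "cong_mod (int p) u w"
    and T: "int p dvd T"
  shows "\<exists>t. int p ^ Suc n dvd rat_part ((1 + of_nat p * \<beta>) ^ t * u) - T"
proof (induction n)
  case 0
  have "int p dvd rat_part u - rat_part w" using u by (simp add: cong_mod_iff)
  then have "int p dvd rat_part u - T" using T by (simp add: w_eq dvd_diff)
  then show ?case by (intro exI[of _ 0]) simp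
next
  case (Suc n)
  define \<gamma> where "\<gamma> = 1 + of_nat p * \<beta>"
  have \<gamma>: "\<gamma> \<in> R" using \<beta> by (simp add: \<gamma>_def)
  have \<gamma>1: "cong_mod (int p) \<gamma> 1" using \<beta> by (auto simp: cong_mod_def \<gamma>_def)
  obtain t where t: "int p ^ Suc n dvd rat_part (\<gamma> ^ t * u) - T" using Suc by (auto simp: \<gamma>_def)
  define v where "v = \<gamma> ^ t * u"
  have v: "v \<in> R" using \<gamma> u by (simp add: v_def)
  have vw: "cong_mod (int p) v w"
    using cong_mod_mult[OF _ _ cong_mod_power[OF \<gamma> R_closed(1) \<gamma>1, of t] u(2)] \<gamma> by (simp add: v_def)
  obtain c where c: "rat_part v - T = int p ^ Suc n * c" using t by (auto simp: v_def)
  obtain b where b: "b \<in> R" "\<gamma> ^ (p ^ n) = 1 + of_nat p ^ Suc n * b" "cong_mod (int p) b \<beta>"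
    using power_of_one_plus[OF \<open>odd p\<close> \<beta>(1), of n] by (auto simp: \<gamma>_def)
  define r where "r = rat_part (b * v)"
  have "cong_mod (int p) (b * v) (\<beta> * w)" using b v vw by (intro cong_mod_mult) auto
  then have "int p dvd r - rat_part (\<beta> * w)" using b v \<beta> unfolding r_def by (intro cong_mod_rat_part) auto
  moreover have "rat_part (\<beta> * w) = - (m * irr_part \<beta>)" using \<beta> by (simp add: rat_part_mult) (simp add: w_eq)
  moreover have "\<not> int p dvd m * irr_part \<beta>"
    using not_dvd_m \<beta>(2) prime_int prime_dvd_multD by blast
  ultimately have "\<not> int p dvd r" by (metis diff_minus_eq_add dvd_add_right_iff)
  then obtain e where e: "int p dvd r * e - 1" by (rule inverse_mod)
  \<comment> \<open>With \<open>e\<close> inverse to \<open>r\<close> modulo p, this solves c + s r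
    = 0 modulo p; the reduction makes \<open>s\<close> a natural exponent.\<close>
  define s where "s = nat ((- c * e) mod int p)"
  have "int s = (- c * e) mod int p" using p_gt_1 by (simp add: s_def)
  then have s: "int p dvd int s - (- c * e)" unfolding mod_eq_dvd_iff[symmetric] by simp
  define x where "x = of_nat p ^ Suc n * b"
  have x: "x \<in> R" using b by (simp add: x_def)
  obtain y where y: "y \<in> R"
    and ex: "(1 + x) ^ s = 1 + of_nat s * x + of_nat (s choose 2) * x\<^sup>2 + x ^ 3 * y"
    using one_plus_power_expansion[of R x s] x by auto
  \<comment> \<open>The quadratic and cubic terms contain p^(2n+2) and p^(3n+3); both are divisible
    by p^(n+2), and \<open>d\<close> is the quotient.\<close>
  define d where "d = (of_nat (s choose 2) * of_nat p ^ n * b\<^sup>2 + of_nat p * (of_nat p ^ n)\<^sup>2 * b ^ 3 * y) * v"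
  have d: "d \<in> R" using y b v by (simp add: d_def)
  have "\<gamma> ^ (p ^ n * s + t) * u = (1 + x) ^ s * v"
    by (simp add: power_add power_mult b(2) x_def v_def)
  also have "\<dots> = v + of_int (int p ^ Suc n * int s) * (b * v) + of_int (int p ^ Suc (Suc n)) * d"
    unfolding ex by (simp add: x_def d_def power2_eq_square power3_eq_cube mult_2 power_add algebra_simps)
  finally have "rat_part (\<gamma> ^ (p ^ n * s + t) * u)
      = rat_part v + (int p ^ Suc n * int s) * r + int p ^ Suc (Suc n) * rat_part d"
    using v b d by (simp only: rat_part_add rat_part_of_int_mult R_closed R_of_int r_def)
  then have "rat_part (\<gamma> ^ (p ^ n * s + t) * u) - T
      = int p ^ Suc n * (c + int s * r) + int p ^ Suc (Suc n) * rat_part d"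
    using c by (simp add: algebra_simps)
  moreover have "int p dvd c + int s * r"
  proof -
    have "c + int s * r = (int s - (- c * e)) * r - c * (r * e - 1)" by (simp add: algebra_simps)
    then show ?thesis using s e by (metis dvd_diff dvd_mult dvd_mult2)
  qed
  then have "int p ^ Suc (Suc n) dvd int p ^ Suc n * (c + int s * r)"
    by (metis mult_dvd_mono dvd_refl power_Suc2)
  ultimately have "int p ^ Suc (Suc n) dvd rat_part (\<gamma> ^ (p ^ n * s + t) * u) - T" by simp
  then show ?case unfolding \<gamma>_def by blast
qed

text \<open>The common power of p is divided out. Since p^k does not divide both entries, this stops
  before exponent \<open>k\<close>, and at least one level of precision remains, written
  \<open>Suc n\<close>.\<close>

lemma split_prime_power:
  assumes "\<not> (int p ^ k dvd x \<and> int p ^ k dvd y)"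
  obtains i n x' y' where "k = i + Suc n" "x = int p ^ i * x'" "y = int p ^ i * y'"
    "\<not> (int p dvd x' \<and> int p dvd y')"
  using assms
proof (induction k arbitrary: x y thesis)
  case 0
  then show ?case by simp
next
  case (Suc k)
  show ?case
  proof (cases "int p dvd x \<and> int p dvd y")
    case True
    then obtain x1 y1 where xy: "x = int p * x1" "y = int p * y1" by (auto elim!: dvdE)
    then have "\<not> (int p ^ k dvd x1 \<and> int p ^ k dvd y1)" using Suc.prems(2) p_gt_1 by auto
    then obtain i n x' y' where "k = i + Suc n" "x1 = int p ^ i * x'" "y1 = int p ^ i * y'"
      "\<not> (int p dvd x' \<and> int p dvd y')" using Suc.IH by blast
    then show ?thesis using Suc.prems(1)[of "Suc i" n x' y'] xy by simp
  next
    case False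
    then show ?thesis using Suc.prems(1)[of 0 k x y] by simp
  qed
qed

text \<open>After removing p^i the target becomes p^n modulo p^(n+1). For n = 0 transitivity modulo
  p suffices; for n > 0 the orbit is first led to w modulo p and then corrected by powers of 1 +
  p\<beta>. The other two properties make the matrix of \<alpha> expanding and its determinant prime
  to p.\<close>

lemma orbit_hit:
  assumes "odd p"
  obtains \<alpha> where "\<alpha> \<in> R" "irr_part \<alpha> \<noteq> 0" "\<not> cong_mod (int p) \<alpha> 0"
    "\<And>x y k. \<not> (int p ^ k dvd x \<and> int p ^ k dvd y) \<Longrightarrow>
      \<exists>j. int p ^ k dvd rat_part (\<alpha> ^ j * elt x y) - int p ^ (k - 1)"
proof -
  obtain \<alpha> \<beta> where \<alpha>: "\<alpha> \<in> R" and \<beta>: "\<beta> \<in> R" "\<alpha> ^ (p\<^sup>2 - 1) = 1 + of_nat p * \<beta>" "\<not> int p dvd irr_part \<beta>"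
    and gen: "\<forall>z\<in>R. \<not> cong_mod (int p) z 0 \<longrightarrow> (\<exists>k. cong_mod (int p) (\<alpha> ^ k) z)"
    by (rule generator_lift)
  define E where "E = p\<^sup>2 - 1"
  have E: "E > 0" using mult_le_mono[of 2 p 2 p] p_gt_1 by (simp add: E_def power2_eq_square)
  have \<alpha>E: "cong_mod (int p) (\<alpha> ^ E) 1" using \<beta> by (auto simp: cong_mod_def E_def)
  have trans: "\<exists>j. cong_mod (int p) (\<alpha> ^ j * u) z"
    if u: "u \<in> R" "\<not> cong_mod (int p) u 0" and z: "z \<in> R" "\<not> cong_mod (int p) z 0" for u z
  proof -
    obtain a b where ab: "cong_mod (int p) (\<alpha> ^ a) u" "cong_mod (int p) (\<alpha> ^ b) z" using gen u z by blast
    \<comment> \<open>The exponent a(E-1) serves as -a, because the E-th power of \<alpha> is 1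
      modulo p.\<close>
    have "cong_mod (int p) (\<alpha> ^ (b + a * (E - 1)) * u) (\<alpha> ^ (b + a * (E - 1)) * \<alpha> ^ a)"
      using \<alpha> u cong_mod_sym[OF ab(1)] by (intro cong_mod_mult) auto
    also have "\<alpha> ^ (b + a * (E - 1)) * \<alpha> ^ a = \<alpha> ^ b * (\<alpha> ^ E) ^ a"
    proof -
      have "b + a * (E - 1) + a = b + E * a" using E by (cases E) (auto simp: algebra_simps)
      then show ?thesis by (simp only: power_add[symmetric] power_mult[symmetric])
    qed
    also have "cong_mod (int p) (\<alpha> ^ b * (\<alpha> ^ E) ^ a) (z * 1 ^ a)"
      using \<alpha> ab(2) \<alpha>E by (intro cong_mod_mult cong_mod_power) auto
    finally show ?thesis by auto
  qed
  have one: "\<not> cong_mod (int p) 1 0" "\<not> cong_mod (int p) w 0"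
    using p_gt_1 by (simp_all add: one_eq zero_eq w_eq cong_mod_elt)
  have "\<not> cong_mod (int p) \<alpha> 0"
  proof
    assume "cong_mod (int p) \<alpha> 0"
    then have "cong_mod (int p) (\<alpha> ^ E) (0 ^ E)" using \<alpha> by (intro cong_mod_power) auto
    with cong_mod_sym[OF \<alpha>E] have "cong_mod (int p) 1 (0 ^ E)" by (rule cong_mod_trans)
    then show False using one E by (simp add: zero_power)
  qed
  \<comment> \<open>Powers of a rational integer stay rational and never reach w modulo p.\<close>
  moreover have "irr_part \<alpha> \<noteq> 0"
  proof
    assume s: "irr_part \<alpha> = 0"
    obtain k where k: "cong_mod (int p) (\<alpha> ^ k) w" using gen one(2) R_closed(3) by blast
    have "\<alpha> = of_int (rat_part \<alpha>)" using R_eq[OF \<alpha>] s by (simp add: elt_of_int)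
    then have "\<alpha> ^ k = elt (rat_part \<alpha> ^ k) 0" by (metis elt_of_int of_int_power)
    then have "int p dvd 1" using k by (simp add: w_eq cong_mod_elt)
    then show False using p_gt_1 by simp
  qed
  moreover have "\<exists>j. int p ^ k dvd rat_part (\<alpha> ^ j * elt x y) - int p ^ (k - 1)"
    if xyk: "\<not> (int p ^ k dvd x \<and> int p ^ k dvd y)" for x y k
  proof -
    obtain i n x' y' where k: "k = i + Suc n" and xy: "x = int p ^ i * x'" "y = int p ^ i * y'"
      and nd: "\<not> (int p dvd x' \<and> int p dvd y')"
      by (rule split_prime_power[OF xyk])
    define u where "u = elt x' y'"
    have u: "u \<in> R" "\<not> cong_mod (int p) u 0" using nd by (simp_all add: u_def zero_eq cong_mod_elt)
    have xyu: "elt x y = of_int (int p ^ i) * u"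
      by (simp only: u_def xy elt_of_int elt_mult) simp
    have "\<exists>j. int p ^ Suc n dvd rat_part (\<alpha> ^ j * u) - int p ^ n"
    proof (cases "n = 0")
      case True
      obtain j where "cong_mod (int p) (\<alpha> ^ j * u) 1" using trans[OF u _ one(1)] by auto
      then have "int p dvd rat_part (\<alpha> ^ j * u) - rat_part 1" using \<alpha> u by (intro cong_mod_rat_part) auto
      then show ?thesis using True by (auto simp: one_eq)
    next
      case False
      obtain j where j: "cong_mod (int p) (\<alpha> ^ j * u) w" using trans[OF u _ one(2)] by auto
      have "int p dvd int p ^ n" using False by (simp add: dvd_power)
      then obtain t where "int p ^ Suc n dvd rat_part ((1 + of_nat p * \<beta>) ^ t * (\<alpha> ^ j * u)) - int p ^ n"
        using first_coordinate_hit[OF \<open>odd p\<close> \<beta>(1,3) _ j] \<alpha> u by auto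
      moreover have "(1 + of_nat p * \<beta>) ^ t * (\<alpha> ^ j * u) = \<alpha> ^ (E * t + j) * u"
        by (simp add: \<beta>(2)[symmetric] E_def power_add power_mult)
      ultimately show ?thesis by metis
    qed
    then obtain j where "int p ^ Suc n dvd rat_part (\<alpha> ^ j * u) - int p ^ n" ..
    then have "int p ^ i * int p ^ Suc n dvd int p ^ i * (rat_part (\<alpha> ^ j * u) - int p ^ n)"
      by (rule mult_dvd_mono[OF dvd_refl])
    moreover have "rat_part (\<alpha> ^ j * elt x y) = int p ^ i * rat_part (\<alpha> ^ j * u)"
      unfolding xyu mult.left_commute[of _ "of_int _"] using \<alpha> u by (intro rat_part_of_int_mult) auto
    ultimately have "int p ^ k dvd rat_part (\<alpha> ^ j * elt x y) - int p ^ (k - 1)"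
      by (simp add: k power_add right_diff_distrib mult.left_commute)
    then show ?thesis by blast
  qed
  ultimately show ?thesis using that[OF \<alpha>] by blast
qed
end

section \<open>Choice of the parameter and of the matrix\<close>

text \<open>Squaring identifies 1 and p - 1, so on the finite set of nonzero residues it is not
  injective, hence not surjective. A residue \<open>r\<close> that is missed is a nonsquare, and
  \<open>m\<close> is a representative of -r.\<close>

lemma inert_parameter_exists:
  assumes "prime p" "odd p"
  obtains m :: int where "m \<ge> 2" "\<forall>x :: int. \<not> int p dvd x\<^sup>2 + m"
proof -
  have p: "p \<ge> 3" using assms by (metis One_nat_def Suc_1 Suc_leI numeral_3_eq_3 odd_one
    even_numeral le_neq_implies_less prime_ge_2_nat)
  define S where "S = {1..<int p}"
  define f where "f x = x\<^sup>2 mod int p" for x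
  have fin: "finite S" by (simp add: S_def)
  have range: "f ` S \<subseteq> S"
  proof
    fix y assume "y \<in> f ` S"
    then obtain x where x: "x \<in> S" "y = x\<^sup>2 mod int p" by (auto simp: f_def)
    have "\<not> int p dvd x" using x(1) by (auto simp: S_def zdvd_not_zless)
    then have "\<not> int p dvd x\<^sup>2" using assms(1) prime_dvd_power[of "int p" x 2] by auto
    then have "y \<noteq> 0" using x(2) by (simp add: mod_eq_0_iff_dvd)
    moreover have "0 \<le> y" "y < int p" using x(2) p by simp_all
    ultimately show "y \<in> S" by (simp add: S_def)
  qed
  have "\<not> inj_on f S"
  proof
    assume inj: "inj_on f S"
    have "f 1 = f (int p - 1)"
    proof -
      have "(int p - 1)\<^sup>2 - 1\<^sup>2 = int p * (int p - 2)" by (simp add: power2_eq_square algebra_simps)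
      then show ?thesis unfolding f_def by (metis dvd_triv_left mod_eq_dvd_iff)
    qed
    moreover have "1 \<in> S" "int p - 1 \<in> S" using p by (auto simp: S_def)
    ultimately have "1 = int p - 1" using inj by (meson inj_onD)
    then show False using p by simp
  qed
  then have "f ` S \<noteq> S" using fin by (metis eq_card_imp_inj_on)
  then obtain r where r: "r \<in> S" "r \<notin> f ` S" using range by auto
  show ?thesis
  proof
    \<comment> \<open>Subtracting from 2p instead of p ensures m > 1 even for r = p - 1.\<close>
    show "2 * int p - r \<ge> 2" using r p by (simp add: S_def)
    show "\<forall>x :: int. \<not> int p dvd x\<^sup>2 + (2 * int p - r)"
    proof (intro allI notI)
      fix x :: int
      assume "int p dvd x\<^sup>2 + (2 * int p - r)"
      then have "int p dvd x\<^sup>2 - r"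
        by (metis add_diff_eq diff_add_eq dvd_add_left_iff dvd_triv_right)
      then have "x\<^sup>2 mod int p = r" using r(1) by (metis S_def atLeastLessThan_iff mod_eq_dvd_iff
            mod_pos_pos_trivial order_trans zero_le_one)
      then have fx: "f (x mod int p) = r" by (simp add: f_def power_mod)
      have "x mod int p \<noteq> 0" using fx r(1) by (auto simp: f_def S_def)
      moreover have "0 \<le> x mod int p" "x mod int p < int p" using p by simp_all
      ultimately have "x mod int p \<in> S" by (simp add: S_def)
      then show False using fx r(2) by blast
    qed
  qed
qed

text \<open>The eigenvalues are a + i sqrt(m) b and its conjugate, with squared modulus equal to the
  norm. Only the product of the off-diagonal entries is prescribed, so transposition makes no
  difference.\<close>

lemma expanding_mult_matrix:
  fixes M :: "real^2^2"
  assumes M: "M$1$1 = a" "M$2$2 = a" "M$1$2 * M$2$1 = - (m * b\<^sup>2)" and m: "m \<ge> 0"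
    and norm: "a\<^sup>2 + m * b\<^sup>2 > 1"
  shows "expanding M"
  unfolding expanding_def
proof (intro allI impI)
  fix c assume "eigenvalue_of M c"
  then obtain v where v: "v \<noteq> 0" "map_matrix complex_of_real M *v v = c *s v"
    by (auto simp: eigenvalue_of_def)
  define B C where "B = complex_of_real (M$1$2)" and "C = complex_of_real (M$2$1)"
  have e: "B * v$2 = (c - a) * v$1" "C * v$1 = (c - a) * v$2"
    using v(2) by (simp_all add: vec_eq_iff forall_2 matrix_vector_mult_def sum_2 M B_def C_def algebra_simps)
  have BC: "B * C = - complex_of_real (m * b\<^sup>2)"
    unfolding B_def C_def of_real_mult[symmetric] M(3) by simp
  have "(c - a)\<^sup>2 * v$1 = (c - a) * (B * v$2)"
    unfolding e(1) power2_eq_square by (simp only: mult.assoc)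
  also have "\<dots> = B * (C * v$1)" unfolding e(2) by (simp only: mult.left_commute)
  finally have "(c - a)\<^sup>2 * v$1 = B * C * v$1" by (simp only: mult.assoc)
  moreover have "(c - a)\<^sup>2 * v$2 = (c - a) * (C * v$1)"
    unfolding e(2) power2_eq_square by (simp only: mult.assoc)
  have "\<dots> = C * (B * v$2)" unfolding e(1) by (simp only: mult.left_commute)
  with \<open>(c - a)\<^sup>2 * v$2 = _\<close> have "(c - a)\<^sup>2 * v$2 = B * C * v$2" by (simp only: mult_ac)
  \<comment> \<open>Some coordinate of the eigenvector is nonzero and can be cancelled.\<close>
  ultimately have "(c - a)\<^sup>2 = B * C"
    using v(1) by (auto simp: vec_eq_iff forall_2)
  also have "\<dots> = (\<i> * complex_of_real (sqrt m * b))\<^sup>2"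
  proof -
    have "(sqrt m * b)\<^sup>2 = m * b\<^sup>2" using m by (simp add: power_mult_distrib)
    moreover have "(\<i> * complex_of_real t)\<^sup>2 = - complex_of_real (t\<^sup>2)" for t
      by (simp add: power_mult_distrib)
    ultimately show ?thesis unfolding BC by presburger
  qed
  finally have "c = a + \<i> * complex_of_real (sqrt m * b) \<or> c = a - \<i> * complex_of_real (sqrt m * b)"
    unfolding power2_eq_iff by (auto simp: algebra_simps)
  then have "(Re c)\<^sup>2 + (Im c)\<^sup>2 = a\<^sup>2 + (sqrt m * b)\<^sup>2" by auto
  then have "(norm c)\<^sup>2 = a\<^sup>2 + m * b\<^sup>2" using m by (simp add: cmod_power2 power_mult_distrib)
  then have "(norm c)\<^sup>2 > 1\<^sup>2" using norm by simp
  then show "norm c > 1" by (rule power2_less_imp_less) simp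
qed

context quad_order begin

text \<open>\<open>A\<close> is the matrix of multiplication by a + bw in the basis 1, w, so its
  powers acting on vectors are powers of a + bw acting on the order.\<close>

lemma mult_matrix_orbit:
  fixes A :: "int^2^2"
  assumes A: "A$1$1 = a" "A$1$2 = - m * b" "A$2$1 = b" "A$2$2 = a"
  shows "elt (((((*v) A) ^^ j) v) $ 1) (((((*v) A) ^^ j) v) $ 2) = elt a b ^ j * elt (v $ 1) (v $ 2)"
proof (induction j)
  case (Suc j)
  let ?u = "(((*v) A) ^^ j) v"
  have "elt ((A *v ?u) $ 1) ((A *v ?u) $ 2) = elt a b * elt (?u $ 1) (?u $ 2)"
    by (simp add: elt_mult matrix_vector_mult_def sum_2 A algebra_simps)
  then show ?case using Suc by (simp add: mult.assoc)
qed simp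

end

section \<open>The main theorem\<close>

theorem theorem1p2:
  fixes p \<eta> :: nat and D :: "(real^2) set"
  assumes "p \<ge> 2" and "\<eta> \<ge> 1" and "finite D"
    and "zero_set (mask_poly D) \<subseteq> E2_ring (p ^ \<eta>) + int_lattice"
  shows "(\<forall>M :: int^2^2. expanding (map_matrix real_of_int M) \<and> gcd (det M) (int p) = 1 \<longrightarrow>
            at_most_orthogonal_exponentials
              (self_affine_measure (map_matrix real_of_int M) D) (p ^ (2 * \<eta>))) \<and>
         (p \<ge> 3 \<and> prime p \<and>
            (\<exists>N :: int. \<not> int p dvd N \<and>
               (\<lambda>x. real_of_int N *\<^sub>R x) ` (A_set p \<eta> + int_lattice) \<subseteq> zero_set (mask_poly D)) \<longrightarrow>
          (\<exists>M :: int^2^2. expanding (map_matrix real_of_int M) \<and> gcd (det M) (int p) = 1 \<and>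
            contains_orthogonal_exponentials
              (self_affine_measure (map_matrix real_of_int M) D) (p ^ (2 * \<eta>))))"
proof (intro conjI allI impI)
  have p: "p > 0" using assms(1) by simp
  \<comment> \<open>With no digits the mask would vanish identically, and 0 would be one of its
    zeros.\<close>
  have "0 \<notin> E2_ring (p ^ \<eta>) + int_lattice"
    using E2_ring_plus_lattice_subset[of "p ^ \<eta>"] p
    by (auto simp: frac_points_def int_lattice_def)
  then have D: "D \<noteq> {}"
    using assms(4) by (auto simp: zero_set_def mask_poly_def)
  {
    fix M :: "int^2^2"
    assume "expanding (map_matrix real_of_int M) \<and> gcd (det M) (int p) = 1"
    then show "at_most_orthogonal_exponentials
        (self_affine_measure (map_matrix real_of_int M) D) (p ^ (2 * \<eta>))"
      using at_most_orthogonal_exponentials_of_zero_set[OF p assms(3) D assms(4)]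
      by (simp add: coprime_iff_gcd_eq_1)
  }
  assume "3 \<le> p \<and> prime p \<and> (\<exists>N :: int. \<not> int p dvd N \<and>
    (\<lambda>x. real_of_int N *\<^sub>R x) ` (A_set p \<eta> + int_lattice) \<subseteq> zero_set (mask_poly D))"
  then obtain N :: int where "3 \<le> p" "prime p" and N: "\<not> int p dvd N"
    and Z: "(\<lambda>x. real_of_int N *\<^sub>R x) ` (A_set p \<eta> + int_lattice) \<subseteq> zero_set (mask_poly D)"
    by auto
  then have odd: "odd p" using prime_odd_nat[of p] by simp
  obtain m :: int where m: "m \<ge> 2" and inert: "\<forall>x :: int. \<not> int p dvd x\<^sup>2 + m"
    by (rule inert_parameter_exists[OF \<open>prime p\<close> odd])
  interpret inert_prime m p
    using m inert \<open>prime p\<close> by unfold_locales auto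
  obtain \<alpha> where \<alpha>: "\<alpha> \<in> R" "irr_part \<alpha> \<noteq> 0" "\<not> cong_mod (int p) \<alpha> 0"
    and hit: "\<And>x y k. \<not> (int p ^ k dvd x \<and> int p ^ k dvd y) \<Longrightarrow>
      \<exists>j. int p ^ k dvd rat_part (\<alpha> ^ j * elt x y) - int p ^ (k - 1)"
    using orbit_hit[OF odd] by metis
  define a b where "a = rat_part \<alpha>" and "b = irr_part \<alpha>"
  have \<alpha>_eq: "\<alpha> = elt a b" using R_eq[OF \<alpha>(1)] by (simp add: a_def b_def)
  \<comment> \<open>It is the transpose that acts on frequencies, so \<open>M\<close> is the
    transpose of the matrix of multiplication by \<alpha>.\<close>
  define M :: "int^2^2" where "M = vector [vector [a, b], vector [- m * b, a]]"
  have M: "M$1$1 = a" "M$1$2 = b" "M$2$1 = - m * b" "M$2$2 = a"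
    by (simp_all add: M_def)
  have "b\<^sup>2 > 0" using \<alpha>(2) by (simp add: b_def)
  then have "b\<^sup>2 \<ge> 1" by linarith
  then have "m * b\<^sup>2 \<ge> 2 * 1" using m by (intro mult_mono) auto
  then have "a\<^sup>2 + m * b\<^sup>2 > 1" using zero_le_power2[of a] by linarith
  then have "real_of_int (a\<^sup>2 + m * b\<^sup>2) > 1" by linarith
  then have exp: "expanding (map_matrix real_of_int M)"
    using m
    by (intro expanding_mult_matrix[where a="of_int a" and b="of_int b" and m="of_int m"])
      (simp_all add: M power2_eq_square)
  have "\<not> (int p dvd a \<and> int p dvd b)"
    using \<alpha>(3) by (simp add: \<alpha>_eq zero_eq cong_mod_elt)
  \<comment> \<open>The determinant is the norm of \<alpha>.\<close>
  then have "\<not> int p dvd det M"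
    using norm_not_dvd[of a b] by (simp add: det_2 M power2_eq_square algebra_simps)
  then have gcd: "gcd (det M) (int p) = 1"
    using prime_imp_coprime[OF prime_int] by (simp add: coprime_iff_gcd_eq_1 gcd.commute)
  have "contains_orthogonal_exponentials
      (self_affine_measure (map_matrix real_of_int M) D) (p ^ (2 * \<eta>))"
  proof (rule contains_orthogonal_exponentials_of_orbits[OF assms(3) D exp p _ Z])
    show "N \<noteq> 0" using N by auto
    fix v :: "int^2"
    assume "\<not> (\<forall>i. int (p ^ \<eta>) dvd v $ i)"
    then obtain j where "int p ^ \<eta> dvd rat_part (\<alpha> ^ j * elt (v $ 1) (v $ 2)) - int p ^ (\<eta> - 1)"
      using hit[of \<eta> "v $ 1" "v $ 2"] by (auto simp: forall_2)
    moreover have "rat_part (\<alpha> ^ j * elt (v $ 1) (v $ 2)) = ((((*v) (transpose M)) ^^ j) v) $ 1"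
      unfolding \<alpha>_eq
      by (subst mult_matrix_orbit[symmetric, where A="transpose M"]) (simp_all add: transpose_def M)
    ultimately show "\<exists>j. int (p ^ \<eta>) dvd ((((*v) (transpose M)) ^^ j) v) $ 1 - int (p ^ (\<eta> - 1))"
      by auto
  qed
  with exp gcd show "\<exists>M :: int^2^2. expanding (map_matrix real_of_int M) \<and> gcd (det M) (int p) = 1 \<and>
      contains_orthogonal_exponentials
        (self_affine_measure (map_matrix real_of_int M) D) (p ^ (2 * \<eta>))"
    by (intro exI[of _ M] conjI)
qed

end
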